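(* Let $g$ be a weak Solovay function. Then a sequence $A\in 2^\omega$ is Martin-Löf random if and only if there is a constant $c$ such that $\mathrm{C}(A\upharpoonright n)\ge n-g(n)-c$ for all $n$.
   Context: $\mathrm{K}$ denotes prefix-free and $\mathrm{C}$ plain Kolmogorov complexity; $A\upharpoonright n$ is the length-$n$ prefix of $A$. A function $g\colon\mathbb{N}\to\mathbb{N}$ is right-c.e. if there is a computable $(x,t)\mapsto g_t(x)$, nonincreasing in $t$, converging to $g(x)$. A weak Solovay function is a right-c.e. function $g$ with $\mathrm{K}(n)\le g(n)+O(1)$ for all $n$ and $g(n)\le\mathrm{K}(n)+O(1)$ for infinitely many $n$. *)

theory Defs
  imports "HOL-Probability.Probability" "HOL-Library.Nat_Bijection" "HOL-Library.Sublist"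
    "HOL-Library.Extended_Nat"
begin

definition minimise :: "(nat \<rightharpoonup> nat) \<Rightarrow> nat \<rightharpoonup> nat" where
  "minimise f a =
     (if \<exists>n. f (prod_encode (a, n)) = Some 0 \<and> (\<forall>m<n. f (prod_encode (a, m)) \<noteq> None)
      then Some (LEAST n. f (prod_encode (a, n)) = Some 0) else None)"

definition prim_rec :: "(nat \<rightharpoonup> nat) \<Rightarrow> (nat \<rightharpoonup> nat) \<Rightarrow> nat \<Rightarrow> nat \<Rightarrow> nat option" where
  "prim_rec f g a m =
     rec_nat (f a) (\<lambda>k r. Option.bind r (\<lambda>y. g (prod_encode (a, prod_encode (k, y))))) m"

text \<open>
  The partial recursive functions, presented with unary functions only: several arguments are
  passed through the Cantor pairing bijection \<^const>\<open>prod_encode\<close>, so that pairing and its two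
  projections replace the projection and tupling schemes of the presentation with arities.
\<close>

inductive partrec :: "(nat \<rightharpoonup> nat) \<Rightarrow> bool" where
  zero: "partrec (\<lambda>n. Some 0)"
| succ: "partrec (\<lambda>n. Some (Suc n))"
| left: "partrec (\<lambda>n. Some (fst (prod_decode n)))"
| right: "partrec (\<lambda>n. Some (snd (prod_decode n)))"
| pair: "partrec f \<Longrightarrow> partrec g \<Longrightarrow>
    partrec (\<lambda>n. Option.bind (f n) (\<lambda>x. Option.bind (g n) (\<lambda>y. Some (prod_encode (x, y)))))"
| comp: "partrec f \<Longrightarrow> partrec g \<Longrightarrow> partrec (\<lambda>n. Option.bind (g n) f)"
| prec: "partrec f \<Longrightarrow> partrec g \<Longrightarrow>
    partrec (\<lambda>n. prim_rec f g (fst (prod_decode n)) (snd (prod_decode n)))"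
| mu: "partrec f \<Longrightarrow> partrec (minimise f)"

definition computable2 :: "(nat \<Rightarrow> nat \<Rightarrow> nat) \<Rightarrow> bool" where
  "computable2 h \<longleftrightarrow> (\<exists>\<phi>. partrec \<phi> \<and> (\<forall>x t. \<phi> (prod_encode (x, t)) = Some (h x t)))"

definition ce_set :: "nat set \<Rightarrow> bool" where
  "ce_set S \<longleftrightarrow> (\<exists>\<phi>. partrec \<phi> \<and> S = dom \<phi>)"

text \<open>
  Strings are identified with natural numbers by the length-lexicographic bijection: the string
  \<open>\<sigma>\<close> corresponds to the number with binary expansion \<open>1\<sigma>\<close>, minus one.
\<close>

definition nat_of_str :: "bool list \<Rightarrow> nat" where
  "nat_of_str \<sigma> = foldl (\<lambda>n b. 2 * n + (if b then 2 else 1)) 0 \<sigma>"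

fun str_of_nat :: "nat \<Rightarrow> bool list" where
  "str_of_nat 0 = []"
| "str_of_nat (Suc n) = str_of_nat (n div 2) @ [odd n]"

lemma nat_of_str_of_nat [simp]: "nat_of_str (str_of_nat n) = n"
proof (induction n rule: str_of_nat.induct)
  case (2 n)
  then show ?case by (cases "even n") (auto simp: nat_of_str_def elim!: evenE oddE)
qed (simp add: nat_of_str_def)

lemma str_of_nat_of_str [simp]: "str_of_nat (nat_of_str \<sigma>) = \<sigma>"
proof (induction \<sigma> rule: rev_induct)
  case (snoc b \<sigma>)
  have "nat_of_str (\<sigma> @ [b]) = Suc (2 * nat_of_str \<sigma> + of_bool b)"
    by (simp add: nat_of_str_def)
  with snoc show ?case by (cases b) simp_all
qed (simp add: nat_of_str_def)

definition restr :: "(nat \<Rightarrow> bool) \<Rightarrow> nat \<Rightarrow> bool list" where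
  "restr A n = map A [0..<n]"

type_synonym machine = "bool list \<rightharpoonup> bool list"

definition plain_machine :: "machine \<Rightarrow> bool" where
  "plain_machine M \<longleftrightarrow>
     (\<exists>\<phi>. partrec \<phi> \<and> (\<forall>p. \<phi> (nat_of_str p) = map_option nat_of_str (M p)))"

definition prefix_free_machine :: "machine \<Rightarrow> bool" where
  "prefix_free_machine M \<longleftrightarrow>
     plain_machine M \<and> (\<forall>p\<in>dom M. \<forall>q\<in>dom M. prefix p q \<longrightarrow> p = q)"

text \<open>The value is \<open>\<infinity>\<close> for strings without a description.\<close>

definition complexity :: "machine \<Rightarrow> bool list \<Rightarrow> enat" where
  "complexity M \<sigma> = (INF p\<in>{p. M p = Some \<sigma>}. enat (length p))"

definition optimal_plain :: "machine \<Rightarrow> bool" where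
  "optimal_plain V \<longleftrightarrow> plain_machine V \<and>
     (\<forall>M. plain_machine M \<longrightarrow> (\<exists>c::nat. \<forall>\<sigma>. complexity V \<sigma> \<le> complexity M \<sigma> + enat c))"

definition optimal_prefix_free :: "machine \<Rightarrow> bool" where
  "optimal_prefix_free U \<longleftrightarrow> prefix_free_machine U \<and>
     (\<forall>M. prefix_free_machine M \<longrightarrow> (\<exists>c::nat. \<forall>\<sigma>. complexity U \<sigma> \<le> complexity M \<sigma> + enat c))"

definition right_ce :: "(nat \<Rightarrow> nat) \<Rightarrow> bool" where
  "right_ce g \<longleftrightarrow>
     (\<exists>h. computable2 h \<and> (\<forall>x. antimono (h x)) \<and> (\<forall>x. h x \<longlonglongrightarrow> g x))"

text \<open>The first argument is the optimal prefix-free machine by which \<open>K\<close> is defined.\<close>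

definition weak_solovay :: "machine \<Rightarrow> (nat \<Rightarrow> nat) \<Rightarrow> bool" where
  "weak_solovay U g \<longleftrightarrow>
     right_ce g \<and>
     (\<exists>c::nat. \<forall>n. complexity U (str_of_nat n) \<le> enat (g n) + enat c) \<and>
     (\<exists>c::nat. \<exists>\<^sub>\<infinity>n. enat (g n) \<le> complexity U (str_of_nat n) + enat c)"

definition coin_measure :: "(nat \<Rightarrow> bool) measure" where
  "coin_measure = PiM UNIV (\<lambda>_. measure_pmf (bernoulli_pmf (1/2)))"

definition open_of :: "bool list set \<Rightarrow> (nat \<Rightarrow> bool) set" where
  "open_of S = {X. \<exists>n. restr X n \<in> S}"

text \<open>A test is given by a uniformly c.e. sequence of sets of strings generating its open sets.\<close>

definition ml_test :: "(nat \<Rightarrow> bool list set) \<Rightarrow> bool" where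
  "ml_test W \<longleftrightarrow>
     ce_set {prod_encode (m, nat_of_str \<sigma>) |m \<sigma>. \<sigma> \<in> W m} \<and>
     (\<forall>m. measure coin_measure (open_of (W m)) \<le> (1/2) ^ m)"

definition ml_random :: "(nat \<Rightarrow> bool) \<Rightarrow> bool" where
  "ml_random A \<longleftrightarrow> (\<forall>W. ml_test W \<longrightarrow> A \<notin> (\<Inter>m. open_of (W m)))"

end

theory Submission
  imports Defs
begin

text \<open>
  If \<open>A\<close> is random, the strings \<open>\<sigma>\<close> of length \<open>n\<close> with \<open>C(\<sigma>) < n - g(n) - m\<close> have measure at most
  \<open>2^(-g(n)-m)\<close>, and \<open>\<Sum>n. 2^(-g(n))\<close> converges by Kraft's inequality since \<open>K \<le> g + O(1)\<close>; so these
  strings form a Martin-Loef test up to a shift of \<open>m\<close>.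

  Conversely let a test cover \<open>A\<close>. Its strings are treated one after the other, in phases. In the
  phase of \<open>\<tau>\<close> one waits until the weight \<open>\<Sum> 2^(-g\<^sub>t(n))\<close> of large \<open>n\<close> exceeds \<open>2^(-|\<tau>|)\<close> by a large factor;
  then the cylinder of \<open>\<tau>\<close> can be split up among these \<open>n\<close> such that every sequence in it has a
  prefix of some such length \<open>n\<close> with a code of length \<open>n - g(n) - r\<close>. While waiting, one requests
  \<open>K(n) \<le> g(n) - r\<close> for all these \<open>n\<close>, which is cheap because their weight is still small. If a phase
  never ends, the requests contradict \<open>g(n) \<le> K(n) + O(1)\<close> for infinitely many \<open>n\<close>. If all phases
  end, \<open>A\<close> has compressible prefixes. Distinct \<open>n\<close> may compete for the same code length
  \<open>n - g(n) - r\<close>; this does no harm, since within a phase the least such \<open>n\<close> carries half of the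
  weight, and a new phase only uses longer codes than the previous ones.
\<close>

section \<open>Computable functions\<close>

abbreviation pfst :: "nat \<Rightarrow> nat" where "pfst n \<equiv> fst (prod_decode n)"
abbreviation psnd :: "nat \<Rightarrow> nat" where "psnd n \<equiv> snd (prod_decode n)"

definition computable :: "(nat \<Rightarrow> nat) \<Rightarrow> bool" where
  "computable f \<longleftrightarrow> partrec (\<lambda>n. Some (f n))"

definition decidable :: "(nat \<Rightarrow> bool) \<Rightarrow> bool" where
  "decidable P \<longleftrightarrow> computable (\<lambda>n. of_bool (P n))"

named_theorems computable_intros

lemma computable_compose:
  assumes "computable f" "computable g"
  shows "computable (\<lambda>x. f (g x))"
  using partrec.comp[of "\<lambda>n. Some (f n)" "\<lambda>n. Some (g n)"] assms by (simp add: computable_def)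

lemma computable_pair [computable_intros]:
  assumes "computable f" "computable g"
  shows "computable (\<lambda>x. prod_encode (f x, g x))"
  using partrec.pair[of "\<lambda>n. Some (f n)" "\<lambda>n. Some (g n)"] assms by (simp add: computable_def)

lemma computable_id [computable_intros]: "computable (\<lambda>x. x)"
proof -
  have "computable (\<lambda>x. prod_encode (pfst x, psnd x))"
    by (intro computable_pair) (simp_all add: computable_def partrec.left partrec.right)
  then show ?thesis by simp
qed

lemma computable_Suc [computable_intros]: "computable f \<Longrightarrow> computable (\<lambda>x. Suc (f x))"
  by (rule computable_compose) (simp_all add: computable_def partrec.succ)

lemma computable_pfst [computable_intros]: "computable f \<Longrightarrow> computable (\<lambda>x. pfst (f x))"
  by (rule computable_compose[of pfst]) (simp_all add: computable_def partrec.left)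

lemma computable_psnd [computable_intros]: "computable f \<Longrightarrow> computable (\<lambda>x. psnd (f x))"
  by (rule computable_compose[of psnd]) (simp_all add: computable_def partrec.right)

lemma computable_const [computable_intros]: "computable (\<lambda>x. c)"
  by (induction c) (auto simp: computable_def[of "\<lambda>_. 0"] partrec.zero intro: computable_Suc)

lemma computable_rec [computable_intros]:
  assumes "computable b" "computable a"
    and "computable (\<lambda>z. G (pfst z) (pfst (psnd z)) (psnd (psnd z)))"
  shows "computable (\<lambda>x. rec_nat (a x) (G x) (b x))"
proof -
  let ?g = "\<lambda>z. Some (G (pfst z) (pfst (psnd z)) (psnd (psnd z)))"
  have eq: "prim_rec (\<lambda>n. Some (a n)) ?g x m = Some (rec_nat (a x) (G x) m)" for x m
    by (induction m) (simp_all add: prim_rec_def)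
  have "computable (\<lambda>z. rec_nat (a (pfst z)) (G (pfst z)) (psnd z))"
    using partrec.prec[of "\<lambda>n. Some (a n)" ?g] assms by (simp add: computable_def eq)
  from computable_compose[OF this, of "\<lambda>x. prod_encode (x, b x)"] show ?thesis
    using assms by (simp add: computable_intros)
qed

section \<open>Closure under arithmetic operations\<close>

lemma computable_add [computable_intros]:
  assumes "computable f" "computable g" shows "computable (\<lambda>x. f x + g x)"
proof -
  have "m + n = rec_nat m (\<lambda>_ y. Suc y) n" for m n :: nat
    by (induction n) simp_all
  moreover have "computable (\<lambda>x. rec_nat (f x) (\<lambda>_ y. Suc y) (g x))"
    by (intro computable_intros assms)
  ultimately show ?thesis by simp
qed

lemma computable_diff [computable_intros]:
  assumes "computable f" "computable g" shows "computable (\<lambda>x. f x - g x)"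
proof -
  have pred: "n - 1 = rec_nat 0 (\<lambda>i _. i) n" for n :: nat
    by (induction n) simp_all
  have "m - n = rec_nat m (\<lambda>_ y. rec_nat 0 (\<lambda>i _. i) y) n" for m n :: nat
    by (induction n) (simp_all flip: pred)
  moreover have "computable (\<lambda>x. rec_nat (f x) (\<lambda>_ y. rec_nat 0 (\<lambda>i _. i) y) (g x))"
    by (intro computable_intros assms)
  ultimately show ?thesis by simp
qed

lemma computable_sum [computable_intros]:
  assumes "computable b" "computable (\<lambda>z. f (pfst z) (psnd z))"
  shows "computable (\<lambda>x. \<Sum>i<b x. f x i)"
proof -
  have "(\<Sum>i<n. f x i) = rec_nat 0 (\<lambda>i y. y + f x i) n" for x n
    by (induction n) simp_all
  moreover have "computable (\<lambda>x. rec_nat 0 (\<lambda>i y. y + f x i) (b x))"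
    using computable_compose[OF assms(2), of "\<lambda>z. prod_encode (pfst z, pfst (psnd z))"]
    by (intro computable_intros assms) (simp add: computable_intros)
  ultimately show ?thesis by simp
qed

lemma computable_mult [computable_intros]:
  assumes "computable f" "computable g" shows "computable (\<lambda>x. f x * g x)"
proof -
  have "computable (\<lambda>x. \<Sum>i<g x. f x)"
    by (intro computable_intros assms computable_compose[OF assms(1)])
  then show ?thesis by (simp add: mult.commute)
qed

lemma computable_power [computable_intros]:
  assumes "computable f" "computable g" shows "computable (\<lambda>x. f x ^ g x)"
proof -
  have "m ^ n = rec_nat 1 (\<lambda>_ y. y * m) n" for m n :: nat
    by (induction n) simp_all
  moreover have "computable (\<lambda>x. rec_nat 1 (\<lambda>_ y. y * f x) (g x))"
    by (intro computable_intros assms computable_compose[OF assms(1)])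
  ultimately show ?thesis by simp
qed

section \<open>Decidable predicates: Boolean operations, comparisons, bounded quantifiers\<close>

lemma computable_of_bool [computable_intros]: "decidable P \<Longrightarrow> computable (\<lambda>x. of_bool (P x))"
  by (simp add: decidable_def)

lemma decidable_const [computable_intros]: "decidable (\<lambda>x. c)"
  by (simp add: decidable_def computable_const)

lemma decidable_not [computable_intros]:
  assumes "decidable P" shows "decidable (\<lambda>x. \<not> P x)"
proof -
  have "of_bool (\<not> P x) = 1 - (of_bool (P x) :: nat)" for x by simp
  moreover have "computable (\<lambda>x. 1 - of_bool (P x))" by (intro computable_intros assms)
  ultimately show ?thesis by (simp add: decidable_def)
qed

lemma decidable_conj [computable_intros]:
  assumes "decidable P" "decidable Q" shows "decidable (\<lambda>x. P x \<and> Q x)"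
proof -
  have "computable (\<lambda>x. of_bool (P x) * of_bool (Q x))" by (intro computable_intros assms)
  then show ?thesis by (simp add: decidable_def of_bool_conj)
qed

lemma decidable_disj [computable_intros]:
  assumes "decidable P" "decidable Q" shows "decidable (\<lambda>x. P x \<or> Q x)"
proof -
  have "decidable (\<lambda>x. \<not> (\<not> P x \<and> \<not> Q x))" by (intro computable_intros assms)
  then show ?thesis by simp
qed

lemma decidable_le [computable_intros]:
  assumes "computable f" "computable g" shows "decidable (\<lambda>x. f x \<le> g x)"
proof -
  have "of_bool (f x \<le> g x) = 1 - (f x - g x)" for x by (cases "f x \<le> g x") simp_all
  moreover have "computable (\<lambda>x. 1 - (f x - g x))" by (intro computable_intros assms)
  ultimately show ?thesis by (simp add: decidable_def)
qed

lemma decidable_less [computable_intros]: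
  assumes "computable f" "computable g" shows "decidable (\<lambda>x. f x < g x)"
proof -
  have "decidable (\<lambda>x. \<not> g x \<le> f x)" by (intro computable_intros assms)
  then show ?thesis by (simp add: not_le)
qed

lemma decidable_eq [computable_intros]:
  assumes "computable f" "computable g" shows "decidable (\<lambda>x. f x = g x)"
proof -
  have "decidable (\<lambda>x. f x \<le> g x \<and> g x \<le> f x)" by (intro computable_intros assms)
  then show ?thesis by (simp add: eq_iff)
qed

lemma decidable_compose:
  "decidable P \<Longrightarrow> computable f \<Longrightarrow> decidable (\<lambda>x. P (f x))"
  unfolding decidable_def by (rule computable_compose)

lemma computable_if [computable_intros]:
  assumes "decidable P" "computable f" "computable g"
  shows "computable (\<lambda>x. if P x then f x else g x)"
proof -
  have "(if P x then f x else g x) = of_bool (P x) * f x + of_bool (\<not> P x) * g x" for x by simp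
  moreover have "computable (\<lambda>x. of_bool (P x) * f x + of_bool (\<not> P x) * g x)"
    by (intro computable_intros assms)
  ultimately show ?thesis by simp
qed

lemma decidable_all_less [computable_intros]:
  assumes "computable b" "decidable (\<lambda>z. P (pfst z) (psnd z))"
  shows "decidable (\<lambda>x. \<forall>i<b x. P x i)"
proof -
  have "(\<forall>i<b x. P x i) \<longleftrightarrow> (\<Sum>i<b x. of_bool (\<not> P x i)) = (0::nat)" for x
    by (auto simp: of_bool_def)
  moreover have "decidable (\<lambda>x. (\<Sum>i<b x. of_bool (\<not> P x i)) = (0::nat))"
    by (intro computable_intros assms)
  ultimately show ?thesis by (simp only:)
qed

lemma decidable_ex_less [computable_intros]:
  assumes "computable b" "decidable (\<lambda>z. P (pfst z) (psnd z))"
  shows "decidable (\<lambda>x. \<exists>i<b x. P x i)"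
proof -
  have "decidable (\<lambda>x. \<not> (\<forall>i<b x. \<not> P x i))" by (intro computable_intros assms)
  then show ?thesis by simp
qed

lemma decidable_all_le [computable_intros]:
  assumes "computable b" "decidable (\<lambda>z. P (pfst z) (psnd z))"
  shows "decidable (\<lambda>x. \<forall>i\<le>b x. P x i)"
proof -
  have "decidable (\<lambda>x. \<forall>i<Suc (b x). P x i)" by (intro computable_intros assms)
  then show ?thesis by (simp add: less_Suc_eq_le)
qed

lemma decidable_ex_le [computable_intros]:
  assumes "computable b" "decidable (\<lambda>z. P (pfst z) (psnd z))"
  shows "decidable (\<lambda>x. \<exists>i\<le>b x. P x i)"
proof -
  have "decidable (\<lambda>x. \<exists>i<Suc (b x). P x i)" by (intro computable_intros assms)
  then show ?thesis by (simp add: less_Suc_eq_le)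
qed

text \<open>The value \<open>b\<close> marks an unsuccessful search, so that the search is
  total.\<close>

definition bounded_least :: "nat \<Rightarrow> (nat \<Rightarrow> bool) \<Rightarrow> nat" where
  "bounded_least b P = (LEAST i. i = b \<or> P i)"

lemma bounded_least_le: "bounded_least b P \<le> b"
  unfolding bounded_least_def by (rule Least_le) simp

lemma bounded_least_less:
  assumes "bounded_least b P < b" shows "P (bounded_least b P)"
  using LeastI[of "\<lambda>i. i = b \<or> P i" b] assms unfolding bounded_least_def by auto

lemma bounded_least_minimal: "P i \<Longrightarrow> bounded_least b P \<le> i"
  unfolding bounded_least_def by (rule Least_le) simp

lemma computable_bounded_least [computable_intros]:
  assumes "computable b" "decidable (\<lambda>z. P (pfst z) (psnd z))"
  shows "computable (\<lambda>x. bounded_least (b x) (P x))"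
proof -
  \<comment> \<open>The least witness equals the number of \<open>i < n\<close> up to which no
    witness has occurred, and a bounded sum can count these.\<close>
  have eq: "bounded_least n Q = (\<Sum>i<n. of_bool (\<forall>j\<le>i. \<not> Q j))" for n Q
  proof -
    have "(\<Sum>i<n. of_bool (\<forall>j\<le>i. \<not> Q j)) = card {i. i < n \<and> (\<forall>j\<le>i. \<not> Q j)}"
      by (simp add: sum_of_bool_eq Int_def)
    also have "{i. i < n \<and> (\<forall>j\<le>i. \<not> Q j)} = {..<bounded_least n Q}"
    proof (intro set_eqI iffI)
      fix i assume i: "i \<in> {i. i < n \<and> (\<forall>j\<le>i. \<not> Q j)}"
      show "i \<in> {..<bounded_least n Q}"
      proof (rule ccontr)
        assume "i \<notin> {..<bounded_least n Q}"
        then have "bounded_least n Q \<le> i" by simp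
        with i bounded_least_less[of n Q] show False by auto
      qed
    next
      fix i assume i: "i \<in> {..<bounded_least n Q}"
      then have "i < n" using bounded_least_le[of n Q] by simp
      moreover have "\<not> Q j" if "j \<le> i" for j
        using bounded_least_minimal[of Q j n] i that by auto
      ultimately show "i \<in> {i. i < n \<and> (\<forall>j\<le>i. \<not> Q j)}" by blast
    qed
    finally show ?thesis by simp
  qed
  \<comment> \<open>Inside the sum the parameter sits one pair deeper, so \<open>P\<close> is
    composed with a rearrangement of the pairs.\<close>
  have "decidable (\<lambda>z. P (pfst (pfst z)) (psnd z))"
    using decidable_compose[OF assms(2), of "\<lambda>z. prod_encode (pfst (pfst z), psnd z)"]
    by (simp add: computable_intros)
  then have "computable (\<lambda>x. \<Sum>i<b x. of_bool (\<forall>j\<le>i. \<not> P x j))"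
    by (intro computable_intros assms)
  then show ?thesis by (simp add: eq)
qed

lemma computable_div [computable_intros]:
  assumes "computable f" "computable g" shows "computable (\<lambda>x. f x div g x)"
proof -
  have eq: "m div n = (if n = 0 then 0 else bounded_least m (\<lambda>q. m < n * Suc q))" for m n :: nat
  proof (cases "n = 0")
    case False
    let ?b = "bounded_least m (\<lambda>q. m < n * Suc q)"
    have "m < n * Suc (m div n)" using False by (metis dividend_less_times_div mult_Suc_right neq0_conv)
    then have "?b \<le> m div n" by (rule bounded_least_minimal)
    moreover have "m div n \<le> ?b"
    proof (cases "?b < m")
      case True
      then have "m < n * Suc ?b" by (rule bounded_least_less)
      then show ?thesis using False by (metis less_Suc_eq_le less_mult_imp_div_less mult.commute)
    next
      case b: False
      then show ?thesis using bounded_least_le[of m "\<lambda>q. m < n * Suc q"]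
        by (meson div_le_dividend le_trans not_le)
    qed
    ultimately show ?thesis using False by simp
  qed simp
  have c: "computable (\<lambda>x. f (pfst x))" "computable (\<lambda>x. g (pfst x))"
    by (rule computable_compose[OF assms(1)] computable_compose[OF assms(2)], intro computable_intros)+
  have "computable (\<lambda>x. if g x = 0 then 0 else bounded_least (f x) (\<lambda>q. f x < g x * Suc q))"
    by (intro computable_intros assms c)
  then show ?thesis by (subst eq)
qed

section \<open>Step-indexed approximations of partial recursive functions\<close>

text \<open>
  The value \<open>0\<close> of \<open>F x s\<close> stands for ``no result within \<open>s\<close> steps'', and \<open>Suc y\<close> for the result \<open>y\<close>.
\<close>

definition approximates :: "(nat \<Rightarrow> nat \<Rightarrow> nat) \<Rightarrow> (nat \<rightharpoonup> nat) \<Rightarrow> bool" where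
  "approximates F \<phi> \<longleftrightarrow> computable (\<lambda>z. F (pfst z) (psnd z)) \<and>
     (\<forall>x s y. F x s = Suc y \<longrightarrow> \<phi> x = Some y) \<and>
     (\<forall>x y. \<phi> x = Some y \<longrightarrow> eventually (\<lambda>s. F x s = Suc y) sequentially)"

lemma approximatesI:
  assumes "computable (\<lambda>z. F (pfst z) (psnd z))"
    and "\<And>x s y. F x s = Suc y \<Longrightarrow> \<phi> x = Some y"
    and "\<And>x y. \<phi> x = Some y \<Longrightarrow> eventually (\<lambda>s. F x s = Suc y) sequentially"
  shows "approximates F \<phi>"
  using assms by (simp add: approximates_def)

lemma approximates_computable:
  assumes "approximates F \<phi>" "computable f" "computable g"
  shows "computable (\<lambda>x. F (f x) (g x))"
proof -
  have "computable (\<lambda>z. F (pfst z) (psnd z))" using assms(1) by (simp add: approximates_def)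
  from computable_compose[OF this, of "\<lambda>x. prod_encode (f x, g x)"] show ?thesis
    using assms by (simp add: computable_intros)
qed

lemma approximates_sound: "approximates F \<phi> \<Longrightarrow> F x s = Suc y \<Longrightarrow> \<phi> x = Some y"
  by (simp add: approximates_def)

lemma approximates_complete:
  "approximates F \<phi> \<Longrightarrow> \<phi> x = Some y \<Longrightarrow> eventually (\<lambda>s. F x s = Suc y) sequentially"
  by (simp add: approximates_def)

lemma approximates_total: "computable f \<Longrightarrow> approximates (\<lambda>x s. Suc (f x)) (\<lambda>x. Some (f x))"
  by (rule approximatesI) (auto intro!: computable_intros intro: computable_compose)

lemma approximates_comp:
  assumes F: "approximates F f" and G: "approximates G g"
  shows "approximates (\<lambda>x s. if G x s = 0 then 0 else F (G x s - 1) s) (\<lambda>x. Option.bind (g x) f)"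
proof (rule approximatesI)
  show "computable (\<lambda>z. if G (pfst z) (psnd z) = 0 then 0 else F (G (pfst z) (psnd z) - 1) (psnd z))"
    by (intro computable_intros approximates_computable[OF F] approximates_computable[OF G])
next
  fix x s y assume "(if G x s = 0 then 0 else F (G x s - 1) s) = Suc y"
  then obtain w where "G x s = Suc w" "F w s = Suc y" by (cases "G x s") auto
  then show "Option.bind (g x) f = Some y"
    using approximates_sound[OF F] approximates_sound[OF G] by simp
next
  fix x y assume "Option.bind (g x) f = Some y"
  then obtain w where w: "g x = Some w" "f w = Some y" by (cases "g x") auto
  from approximates_complete[OF G w(1)] approximates_complete[OF F w(2)]
  show "eventually (\<lambda>s. (if G x s = 0 then 0 else F (G x s - 1) s) = Suc y) sequentially"
    by eventually_elim simp
qed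

lemma approximates_pair:
  assumes F: "approximates F f" and G: "approximates G g"
  shows "approximates (\<lambda>x s. if F x s = 0 \<or> G x s = 0 then 0 else Suc (prod_encode (F x s - 1, G x s - 1)))
    (\<lambda>n. Option.bind (f n) (\<lambda>x. Option.bind (g n) (\<lambda>y. Some (prod_encode (x, y)))))"
proof (rule approximatesI)
  show "computable (\<lambda>z. if F (pfst z) (psnd z) = 0 \<or> G (pfst z) (psnd z) = 0 then 0
      else Suc (prod_encode (F (pfst z) (psnd z) - 1, G (pfst z) (psnd z) - 1)))"
    by (intro computable_intros approximates_computable[OF F] approximates_computable[OF G])
next
  fix x s y
  assume a: "(if F x s = 0 \<or> G x s = 0 then 0 else Suc (prod_encode (F x s - 1, G x s - 1))) = Suc y"
  then obtain v w where vw: "F x s = Suc v" "G x s = Suc w" by (cases "F x s"; cases "G x s") auto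
  then have "f x = Some v" "g x = Some w"
    using approximates_sound[OF F] approximates_sound[OF G] by auto
  then show "Option.bind (f x) (\<lambda>v. Option.bind (g x) (\<lambda>w. Some (prod_encode (v, w)))) = Some y"
    using a vw by simp
next
  fix x y assume a: "Option.bind (f x) (\<lambda>v. Option.bind (g x) (\<lambda>w. Some (prod_encode (v, w)))) = Some y"
  then obtain v w where vw: "f x = Some v" "g x = Some w" by (cases "f x"; cases "g x") auto
  from approximates_complete[OF F vw(1)] approximates_complete[OF G vw(2)]
  show "eventually (\<lambda>s. (if F x s = 0 \<or> G x s = 0 then 0
      else Suc (prod_encode (F x s - 1, G x s - 1))) = Suc y) sequentially"
    by eventually_elim (use a vw in simp)
qed

text \<open>One step bound \<open>s\<close> serves all stages of the recursion: a value of
  \<open>prim_rec\<close> depends on finitely many evaluations, all of which have settled once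
  \<open>s\<close> is large.\<close>

lemma approximates_prim_rec:
  assumes F: "approximates F f" and G: "approximates G g"
  defines "R \<equiv> \<lambda>a s. rec_nat (F a s)
      (\<lambda>k r. if r = 0 then 0 else G (prod_encode (a, prod_encode (k, r - 1))) s)"
  shows "approximates (\<lambda>x s. R (pfst x) s (psnd x)) (\<lambda>n. prim_rec f g (pfst n) (psnd n))"
proof (rule approximatesI)
  show "computable (\<lambda>z. R (pfst (pfst z)) (psnd z) (psnd (pfst z)))"
    unfolding R_def by (intro computable_intros approximates_computable[OF F] approximates_computable[OF G])
next
  have *: "prim_rec f g a m = Some y" if "R a s m = Suc y" for a s m y
    using that
  proof (induction m arbitrary: y)
    case 0
    then show ?case using approximates_sound[OF F] by (simp add: R_def prim_rec_def)
  next
    case (Suc m)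
    then obtain w where w: "R a s m = Suc w" by (cases "R a s m") (auto simp: R_def)
    with Suc have "prim_rec f g a m = Some w" by simp
    moreover have "g (prod_encode (a, prod_encode (m, w))) = Some y"
      using Suc.prems w by (intro approximates_sound[OF G, of _ s]) (simp add: R_def)
    ultimately show ?case by (simp add: prim_rec_def)
  qed
  show "prim_rec f g (pfst x) (psnd x) = Some y" if "R (pfst x) s (psnd x) = Suc y" for x s y
    using * that by simp
next
  have *: "eventually (\<lambda>s. R a s m = Suc y) sequentially" if "prim_rec f g a m = Some y" for a m y
    using that
  proof (induction m arbitrary: y)
    case 0
    then show ?case using approximates_complete[OF F] by (simp add: R_def prim_rec_def)
  next
    case (Suc m)
    then obtain w where w: "prim_rec f g a m = Some w" by (cases "prim_rec f g a m") (auto simp: prim_rec_def)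
    with Suc.prems have "g (prod_encode (a, prod_encode (m, w))) = Some y" by (simp add: prim_rec_def)
    from approximates_complete[OF G this] Suc.IH[OF w] show ?case
      by eventually_elim (simp add: R_def)
  qed
  show "eventually (\<lambda>s. R (pfst x) s (psnd x) = Suc y) sequentially"
    if "prim_rec f g (pfst x) (psnd x) = Some y" for x y
    using * that by simp
qed

text \<open>A result is announced only when all smaller arguments have converged, because
  \<open>minimise\<close> is undefined otherwise. The value 1 of \<open>F\<close> stands for the
  result 0.\<close>

lemma approximates_minimise:
  assumes F: "approximates F f"
  defines "B \<equiv> \<lambda>a s. bounded_least s (\<lambda>n. F (prod_encode (a, n)) s = 1)"
  shows "approximates (\<lambda>a s. if B a s < s \<and> (\<forall>m<B a s. F (prod_encode (a, m)) s \<noteq> 0) then Suc (B a s) else 0)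
    (minimise f)"
proof (rule approximatesI)
  show "computable (\<lambda>z. if B (pfst z) (psnd z) < psnd z \<and>
      (\<forall>m<B (pfst z) (psnd z). F (prod_encode (pfst z, m)) (psnd z) \<noteq> 0) then Suc (B (pfst z) (psnd z)) else 0)"
    unfolding B_def by (intro computable_intros approximates_computable[OF F])
next
  fix a s y
  assume "(if B a s < s \<and> (\<forall>m<B a s. F (prod_encode (a, m)) s \<noteq> 0) then Suc (B a s) else 0) = Suc y"
  then have y: "B a s = y" "y < s" "\<And>m. m < y \<Longrightarrow> F (prod_encode (a, m)) s \<noteq> 0"
    by (auto split: if_splits)
  have "F (prod_encode (a, y)) s = 1" using bounded_least_less y unfolding B_def by blast
  then have fy: "f (prod_encode (a, y)) = Some 0" using approximates_sound[OF F] by simp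
  have fm: "\<exists>w. f (prod_encode (a, m)) = Some (Suc w)" if "m < y" for m
  proof -
    obtain w where w: "F (prod_encode (a, m)) s = Suc w" using y(3)[OF \<open>m < y\<close>] by (cases "F (prod_encode (a, m)) s") auto
    have "w \<noteq> 0"
    proof
      assume "w = 0"
      then have "B a s \<le> m" unfolding B_def using w by (intro bounded_least_minimal) simp
      then show False using y(1) \<open>m < y\<close> by simp
    qed
    then show ?thesis using approximates_sound[OF F w] by (cases w) auto
  qed
  have "(LEAST n. f (prod_encode (a, n)) = Some 0) = y"
    by (rule Least_equality) (use fy fm in \<open>force simp: not_le[symmetric]\<close>)+
  then show "minimise f a = Some y"
    using fy fm unfolding minimise_def by fastforce
next
  fix a y assume min: "minimise f a = Some y"
  then have ex: "\<exists>n. f (prod_encode (a, n)) = Some 0 \<and> (\<forall>m<n. f (prod_encode (a, m)) \<noteq> None)"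
    and y: "y = (LEAST n. f (prod_encode (a, n)) = Some 0)"
    unfolding minimise_def by (auto split: if_splits)
  from ex obtain n where n: "f (prod_encode (a, n)) = Some 0" "\<And>m. m < n \<Longrightarrow> f (prod_encode (a, m)) \<noteq> None"
    by blast
  have fy: "f (prod_encode (a, y)) = Some 0" unfolding y by (rule LeastI) (rule n)
  have "y \<le> n" unfolding y by (rule Least_le) (rule n)
  have fm: "\<exists>w. f (prod_encode (a, m)) = Some (Suc w)" if "m < y" for m
  proof -
    have "f (prod_encode (a, m)) \<noteq> None" using n(2)[of m] that \<open>y \<le> n\<close> by simp
    moreover have "f (prod_encode (a, m)) \<noteq> Some 0" using not_less_Least that unfolding y by blast
    ultimately show ?thesis by (metis not0_implies_Suc option.exhaust)
  qed
  \<comment> \<open>Nonzero results appear as values at least 2. Once all those below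
    \<open>y\<close> are present, the bounded search cannot stop before \<open>y\<close>.\<close>
  have "eventually (\<lambda>s. \<forall>m\<in>{..<y}. F (prod_encode (a, m)) s \<ge> 2) sequentially"
  proof (rule eventually_ball_finite)
    show "\<forall>m\<in>{..<y}. eventually (\<lambda>s. F (prod_encode (a, m)) s \<ge> 2) sequentially"
    proof
      fix m assume "m \<in> {..<y}"
      then obtain w where "f (prod_encode (a, m)) = Some (Suc w)" using fm by auto
      from approximates_complete[OF F this]
      show "eventually (\<lambda>s. F (prod_encode (a, m)) s \<ge> 2) sequentially" by eventually_elim simp
    qed
  qed simp
  with approximates_complete[OF F fy] eventually_gt_at_top[of y]
  show "eventually (\<lambda>s. (if B a s < s \<and> (\<forall>m<B a s. F (prod_encode (a, m)) s \<noteq> 0) then Suc (B a s) else 0)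
      = Suc y) sequentially"
  proof eventually_elim
    case (elim s)
    have "B a s \<le> y" unfolding B_def using elim by (intro bounded_least_minimal) simp
    moreover have "\<not> B a s < y"
    proof
      assume "B a s < y"
      then have "F (prod_encode (a, B a s)) s = 1"
        using bounded_least_less[of s "\<lambda>n. F (prod_encode (a, n)) s = 1"] elim unfolding B_def by auto
      then show False using elim \<open>B a s < y\<close> by force
    qed
    ultimately have "B a s = y" by simp
    moreover have "\<forall>m<y. F (prod_encode (a, m)) s \<noteq> 0"
      using elim by (metis lessThan_iff not_numeral_le_zero)
    ultimately show ?case using elim by simp
  qed
qed

theorem partrec_approximation: "partrec \<phi> \<Longrightarrow> \<exists>F. approximates F \<phi>"
proof (induction rule: partrec.induct)
  case zero
  show ?case using approximates_total[of "\<lambda>_. 0"] by (blast intro: computable_intros)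
next
  case succ
  show ?case using approximates_total[of Suc] computable_Suc[OF computable_id] by blast
next
  case left
  show ?case using approximates_total[of pfst] computable_pfst[OF computable_id] by blast
next
  case right
  show ?case using approximates_total[of psnd] computable_psnd[OF computable_id] by blast
qed (use approximates_pair approximates_comp approximates_prim_rec approximates_minimise in blast)+

section \<open>Machines given by computable sequences of codes\<close>

lemma nat_of_str_append: "nat_of_str (\<sigma> @ \<rho>) = nat_of_str \<sigma> * 2 ^ length \<rho> + nat_of_str \<rho>"
proof (induction \<rho> rule: rev_induct)
  case (snoc b \<rho>)
  have "nat_of_str (\<tau> @ [b]) = 2 * nat_of_str \<tau> + (if b then 2 else 1)" for \<tau>
    by (simp add: nat_of_str_def)
  from this[of "\<sigma> @ \<rho>"] this[of \<rho>] snoc show ?case by (simp add: algebra_simps)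
qed (simp add: nat_of_str_def)

text \<open>The binary expansion of \<open>Suc (nat_of_str \<sigma>)\<close> is a one followed by
  \<sigma>, so its size determines the length of \<sigma>.\<close>

lemma nat_of_str_bounds: "2 ^ length \<sigma> \<le> Suc (nat_of_str \<sigma>)" "Suc (nat_of_str \<sigma>) < 2 ^ Suc (length \<sigma>)"
proof (induction \<sigma> rule: rev_induct)
  case (snoc b \<sigma>)
  case 1 show ?case using snoc by (simp add: nat_of_str_def)
next
  case (snoc b \<sigma>)
  case 2 show ?case using snoc by (simp add: nat_of_str_def)
qed (simp_all add: nat_of_str_def)

lemma inj_nat_of_str: "nat_of_str \<sigma> = nat_of_str \<tau> \<longleftrightarrow> \<sigma> = \<tau>"
  by (metis str_of_nat_of_str)

abbreviation slen :: "nat \<Rightarrow> nat" where "slen n \<equiv> length (str_of_nat n)"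

lemma slen_bounds: "2 ^ slen n \<le> Suc n" "Suc n < 2 ^ Suc (slen n)"
  using nat_of_str_bounds[of "str_of_nat n"] by simp_all

lemma slen_eqI:
  assumes "2 ^ l \<le> Suc n" "Suc n < 2 ^ Suc l"
  shows "slen n = l"
proof (rule antisym)
  have "(2::nat) ^ slen n < 2 ^ Suc l" "(2::nat) ^ l < 2 ^ Suc (slen n)"
    using slen_bounds[of n] assms by linarith+
  then show "slen n \<le> l" "l \<le> slen n"
    by (auto dest: power_less_imp_less_exp[rotated] simp del: power_Suc)
qed

lemma slen_le: "slen n \<le> n"
  using slen_bounds(1)[of n] less_exp[of "slen n"] by linarith

lemma computable_slen [computable_intros]:
  assumes "computable f" shows "computable (\<lambda>x. slen (f x))"
proof -
  have "slen n = bounded_least n (\<lambda>l. Suc n < 2 ^ Suc l)" for n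
  proof (rule antisym)
    show "bounded_least n (\<lambda>l. Suc n < 2 ^ Suc l) \<le> slen n"
      by (rule bounded_least_minimal) (rule slen_bounds)
    show "slen n \<le> bounded_least n (\<lambda>l. Suc n < 2 ^ Suc l)" (is "_ \<le> ?b")
    proof (cases "?b < n")
      case True
      then have "Suc n < 2 ^ Suc ?b" by (rule bounded_least_less)
      then have "(2::nat) ^ slen n < 2 ^ Suc ?b" using slen_bounds(1)[of n] by linarith
      then show ?thesis by (auto dest: power_less_imp_less_exp[rotated] simp del: power_Suc)
    next
      case False
      then show ?thesis using slen_le[of n] by simp
    qed
  qed
  moreover have "computable (\<lambda>n. bounded_least n (\<lambda>l. Suc n < 2 ^ Suc l))"
    by (intro computable_intros)
  ultimately have "computable (\<lambda>n. slen n)" by simp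
  from computable_compose[OF this assms] show ?thesis .
qed

text \<open>Each index \<open>i\<close> in \<open>D\<close> contributes a pair of a description
  \<open>code i\<close> and an output \<open>out i\<close>. Taking the least index keeps the machine
  single-valued when several indices share a code.\<close>

definition search_machine :: "(nat \<Rightarrow> bool) \<Rightarrow> (nat \<Rightarrow> nat) \<Rightarrow> (nat \<Rightarrow> nat) \<Rightarrow> machine" where
  "search_machine D code out p =
     (if \<exists>i. D i \<and> code i = nat_of_str p
      then Some (str_of_nat (out (LEAST i. D i \<and> code i = nat_of_str p))) else None)"

lemma plain_machine_search_machine:
  assumes "decidable D" "computable code" "computable out"
  shows "plain_machine (search_machine D code out)"
proof -
  let ?test = "\<lambda>z. of_bool (\<not> (D (psnd z) \<and> code (psnd z) = pfst z)) :: nat"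
  have "computable ?test"
    by (intro computable_intros decidable_compose[OF assms(1)] computable_compose[OF assms(2)])
  then have "partrec (\<lambda>n. Option.bind (minimise (\<lambda>z. Some (?test z)) n) (\<lambda>i. Some (out i)))"
    using assms(3) by (intro partrec.comp partrec.mu) (simp_all add: computable_def)
  moreover have "Option.bind (minimise (\<lambda>z. Some (?test z)) (nat_of_str p)) (\<lambda>i. Some (out i)) =
      map_option nat_of_str (search_machine D code out p)" for p
    by (simp add: minimise_def search_machine_def)
  ultimately show ?thesis unfolding plain_machine_def by blast
qed

lemma search_machine_eq:
  assumes "D i" "\<And>j. D j \<Longrightarrow> code j = code i \<Longrightarrow> out j = out i"
  shows "search_machine D code out (str_of_nat (code i)) = Some (str_of_nat (out i))"
proof -
  have "out (LEAST j. D j \<and> code j = code i) = out i"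
  proof (rule LeastI2[of _ i])
    show "out j = out i" if "D j \<and> code j = code i" for j using assms(2) that by blast
  qed (simp add: assms(1))
  then show ?thesis using assms(1) by (auto simp: search_machine_def)
qed

section \<open>Upper bounds for plain and prefix-free complexity\<close>

lemma complexity_le: "M p = Some \<sigma> \<Longrightarrow> complexity M \<sigma> \<le> enat (length p)"
  unfolding complexity_def by (rule INF_lower) simp

text \<open>A nonempty set in \<open>enat\<close> contains its infimum, and a finite bound excludes
  the empty set, whose infimum is \<infinity>.\<close>

lemma complexity_attained:
  assumes "complexity M \<sigma> \<le> enat k"
  obtains p where "M p = Some \<sigma>" "length p \<le> k"
proof -
  let ?L = "(\<lambda>p. enat (length p)) ` {p. M p = Some \<sigma>}"
  have "?L \<noteq> {}"
  proof
    assume "?L = {}"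
    then have "complexity M \<sigma> = \<infinity>" unfolding complexity_def by (simp only: Inf_enat_def) simp
    then show False using assms by simp
  qed
  then have "Inf ?L \<in> ?L" unfolding Inf_enat_def using LeastI[of "\<lambda>x. x \<in> ?L"] by fastforce
  then show ?thesis using assms that unfolding complexity_def by auto
qed

theorem optimal_plain_bound:
  assumes "optimal_plain V" "decidable D" "computable code" "computable out"
    and "\<And>i j. D i \<Longrightarrow> D j \<Longrightarrow> code i = code j \<Longrightarrow> out i = out j"
  shows "\<exists>c. \<forall>i. D i \<longrightarrow> complexity V (str_of_nat (out i)) \<le> enat (slen (code i) + c)"
proof -
  let ?M = "search_machine D code out"
  obtain c where c: "\<And>\<sigma>. complexity V \<sigma> \<le> complexity ?M \<sigma> + enat c"
    using assms(1) plain_machine_search_machine[OF assms(2-4)] unfolding optimal_plain_def by blast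
  have "complexity V (str_of_nat (out i)) \<le> enat (slen (code i) + c)" if "D i" for i
  proof -
    have "?M (str_of_nat (code i)) = Some (str_of_nat (out i))"
    proof (rule search_machine_eq[where D=D, OF that])
      show "out j = out i" if "D j" "code j = code i" for j
        using assms(5)[OF that(1) \<open>D i\<close> that(2)] .
    qed
    from complexity_le[where M="?M", OF this] have "complexity ?M (str_of_nat (out i)) + enat c \<le> enat (slen (code i)) + enat c"
      by (rule add_right_mono)
    with c[of "str_of_nat (out i)"] show ?thesis by simp
  qed
  then show ?thesis by blast
qed

lemma ceiling_div_bounds:
  fixes x b :: nat assumes "b > 0"
  shows "x \<le> (x + b - 1) div b * b" "(x + b - 1) div b * b < x + b"
proof -
  have "(x + b - 1) div b * b + (x + b - 1) mod b = x + b - 1" by (rule div_mult_mod_eq)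
  moreover have "(x + b - 1) mod b < b" using assms by simp
  ultimately show "x \<le> (x + b - 1) div b * b" "(x + b - 1) div b * b < x + b" using assms by linarith+
qed

text \<open>
  Shannon--Fano--Elias coding: a request of length \<open>k\<close> owns an interval of length \<open>2^(-k)\<close>, which
  contains a dyadic interval of length \<open>2^(-k-1)\<close>. This costs one bit more than the Kraft--Chaitin
  theorem, but no bookkeeping of the free intervals.
\<close>

theorem optimal_prefix_free_bound:
  assumes U: "optimal_prefix_free U" and D: "decidable D" and k: "computable k" and out: "computable out"
    and weight: "\<And>N. (\<Sum>i<N. of_bool (D i) * (1/2) ^ k i) \<le> (1::real)"
  shows "\<exists>c. \<forall>i. D i \<longrightarrow> complexity U (str_of_nat (out i)) \<le> enat (k i + c)"
proof -
  \<comment> \<open>\<open>2 ^ E i\<close> is a common denominator of the weights of the requests up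
    to \<open>i\<close>, and \<open>N i\<close> is the numerator of \<open>S i\<close> over it. This
    keeps the coding within integer arithmetic.\<close>
  define E where "E i = (\<Sum>j<Suc i. k j)" for i
  define N where "N i = (\<Sum>j<i. of_bool (D j) * 2 ^ (E i - k j) :: nat)" for i
  \<comment> \<open>This is the ceiling of \<open>S i * 2 ^ Suc (k i)\<close>: the dyadic interval
    from \<open>p i\<close> to \<open>p i + 1\<close> in units of \<open>2^(-k i - 1)\<close> is the
    first one to the right of \<open>S i\<close>.\<close>
  define p where "p i = (N i * 2 ^ Suc (k i) + 2 ^ E i - 1) div 2 ^ E i" for i
  \<comment> \<open>\<open>2 ^ Suc (k i) - 1\<close> is the number of the first string of length
    \<open>Suc (k i)\<close>, so \<open>code i\<close> is the string of that length with binary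
    value \<open>p i\<close>.\<close>
  define code where "code i = 2 ^ Suc (k i) - 1 + p i" for i
  define S where "S i = (\<Sum>j<i. of_bool (D j) * (1/2) ^ k j :: real)" for i
  have k_le_E: "k j \<le> E i" if "j \<le> i" for i j
    unfolding E_def using that by (intro member_le_sum) auto
  have N_eq: "real (N i) = S i * 2 ^ E i" for i
  proof -
    have "(2::real) ^ (E i - k j) = (1/2) ^ k j * 2 ^ E i" if "j < i" for j
      using that by (simp add: power_diff k_le_E power_divide)
    then show ?thesis
      unfolding N_def S_def sum_distrib_right of_nat_sum by (intro sum.cong refl) simp
  qed
  have p_bounds: "S i * 2 ^ Suc (k i) \<le> p i" "p i < S i * 2 ^ Suc (k i) + 1" for i
  proof -
    have "N i * 2 ^ Suc (k i) \<le> p i * 2 ^ E i" "p i * 2 ^ E i < N i * 2 ^ Suc (k i) + 2 ^ E i"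
      unfolding p_def by (rule ceiling_div_bounds, simp)+
    then have "real (N i * 2 ^ Suc (k i)) \<le> real (p i * 2 ^ E i)"
        "real (p i * 2 ^ E i) < real (N i * 2 ^ Suc (k i) + 2 ^ E i)"
      by (simp_all only: of_nat_le_iff of_nat_less_iff)
    then have "(S i * 2 ^ Suc (k i)) * 2 ^ E i \<le> real (p i) * 2 ^ E i"
        "real (p i) * 2 ^ E i < (S i * 2 ^ Suc (k i) + 1) * 2 ^ E i"
      unfolding of_nat_mult of_nat_add of_nat_power N_eq by (simp_all only: of_nat_numeral ring_distribs mult_ac mult_1_left)
    then show "S i * 2 ^ Suc (k i) \<le> p i" "p i < S i * 2 ^ Suc (k i) + 1"
      by (simp_all only: mult_le_cancel_right_pos mult_less_cancel_right_pos zero_less_power zero_less_numeral)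
  qed
  have S_next: "S i + (1/2) ^ k i \<le> S j" if "D i" "i < j" for i j
  proof -
    have "S (Suc i) \<le> S j" unfolding S_def using that by (intro sum_mono2) auto
    then show ?thesis using that by (simp add: S_def)
  qed
  have p_next: "real (p i) + 1 < (S i + (1/2) ^ k i) * 2 ^ Suc (k i)" for i
    using p_bounds(2)[of i] by (simp add: algebra_simps power_divide)
  have p_less: "p i < 2 ^ Suc (k i)" if "D i" for i
  proof -
    have "S i + (1/2) ^ k i \<le> 1" using weight[of "Suc i"] that by (simp add: S_def)
    then have "(S i + (1/2) ^ k i) * 2 ^ Suc (k i) \<le> 1 * 2 ^ Suc (k i)" by (rule mult_right_mono) simp
    with p_next[of i] have "real (p i) < 2 ^ Suc (k i)" by linarith
    then have "real (p i) < real (2 ^ Suc (k i))" by simp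
    then show ?thesis by (simp only: of_nat_less_iff)
  qed
  have slen_code: "slen (code i) = Suc (k i)" if "D i" for i
    using p_less[OF that] by (intro slen_eqI) (auto simp: code_def)
  have free: "i = j" if "D i" "D j" and pre: "prefix (str_of_nat (code i)) (str_of_nat (code j))" for i j
  proof (rule ccontr)
    assume "i \<noteq> j"
    obtain \<rho> where \<rho>: "str_of_nat (code j) = str_of_nat (code i) @ \<rho>" using pre by (auto simp: prefix_def)
    define u where "u = length \<rho>"
    have len: "Suc (k j) = Suc (k i) + u"
      using arg_cong[OF \<rho>, of length] slen_code that by (simp add: u_def)
    have "code j = code i * 2 ^ u + nat_of_str \<rho>"
      using arg_cong[OF \<rho>, of nat_of_str] by (simp add: nat_of_str_append u_def)
    then have "Suc (code j) + 2 ^ u = Suc (code i) * 2 ^ u + Suc (nat_of_str \<rho>)" by simp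
    moreover have "Suc (code l) = 2 ^ Suc (k l) + p l" for l by (simp add: code_def)
    moreover have "(2::nat) ^ Suc (k j) = 2 ^ Suc (k i) * 2 ^ u" unfolding len by (rule power_add)
    ultimately have "p j + 2 ^ u = p i * 2 ^ u + Suc (nat_of_str \<rho>)" by (simp only: add_mult_distrib)
    with nat_of_str_bounds[of \<rho>] have "p i * 2 ^ u \<le> p j" "p j + 1 \<le> (p i + 1) * 2 ^ u"
      by (simp_all add: u_def)
    then have *: "real (p i) * 2 ^ u \<le> p j" "real (p j) + 1 \<le> (p i + 1) * 2 ^ u"
      by (metis of_nat_le_iff of_nat_mult of_nat_numeral of_nat_power,
          metis of_nat_1 of_nat_add of_nat_le_iff of_nat_mult of_nat_numeral of_nat_power)
    have pow: "(2::real) ^ Suc (k j) = 2 ^ Suc (k i) * 2 ^ u" unfolding len by (rule power_add)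
    \<comment> \<open>A prefix relation means that the dyadic interval of \<open>j\<close> lies in
      that of \<open>i\<close>. But each dyadic interval lies in the interval of its own request,
      and the one requested earlier ends before the other begins.\<close>
    show False
    proof (cases "i < j")
      case True
      have "(real (p i) + 1) * 2 ^ u < (S i + (1/2) ^ k i) * 2 ^ Suc (k i) * 2 ^ u"
        using p_next[of i] by (intro mult_strict_right_mono) simp_all
      also have "\<dots> \<le> S j * 2 ^ Suc (k j)"
        unfolding pow mult.assoc[symmetric] using S_next[OF \<open>D i\<close> True] by (intro mult_right_mono) simp_all
      also have "\<dots> \<le> p j" by (rule p_bounds)
      finally show False using * by (simp add: algebra_simps)
    next
      case False
      then have "j < i" using \<open>i \<noteq> j\<close> by simp
      have "real (p j) + 1 < (S j + (1/2) ^ k j) * 2 ^ Suc (k j)" by (rule p_next)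
      also have "\<dots> \<le> S i * 2 ^ Suc (k j)" using S_next[OF \<open>D j\<close> \<open>j < i\<close>] by (intro mult_right_mono) simp_all
      also have "\<dots> = S i * 2 ^ Suc (k i) * 2 ^ u" by (simp only: pow mult.assoc)
      also have "\<dots> \<le> real (p i) * 2 ^ u" using p_bounds(1)[of i] by (intro mult_right_mono) simp_all
      finally show False using * by simp
    qed
  qed
  have "computable (\<lambda>i. E i)" unfolding E_def
    by (intro computable_intros computable_compose[OF k])
  then have E': "computable E" "computable (\<lambda>z. E (pfst z))"
    using computable_compose[of E, OF _ computable_pfst[OF computable_id]] by simp_all
  have "computable (\<lambda>i. N i)" unfolding N_def
    by (intro computable_intros computable_compose[OF k] decidable_compose[OF D] E')
  then have "computable code" unfolding code_def p_def
    by (intro computable_intros k E')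
  let ?M = "search_machine D code out"
  have plain: "plain_machine ?M" by (rule plain_machine_search_machine) fact+
  have "prefix_free_machine ?M"
    unfolding prefix_free_machine_def
  proof (intro conjI ballI impI plain)
    fix s t assume "s \<in> dom ?M" "t \<in> dom ?M" and pre: "prefix s t"
    then obtain i j where ij: "D i" "code i = nat_of_str s" "D j" "code j = nat_of_str t"
      by (auto simp: search_machine_def split: if_splits)
    then have "i = j" using pre by (intro free) simp_all
    then show "s = t" using ij inj_nat_of_str by metis
  qed
  then obtain c where c: "\<And>\<sigma>. complexity U \<sigma> \<le> complexity ?M \<sigma> + enat c"
    using U unfolding optimal_prefix_free_def by blast
  have "complexity U (str_of_nat (out i)) \<le> enat (k i + Suc c)" if "D i" for i
  proof -
    have "?M (str_of_nat (code i)) = Some (str_of_nat (out i))"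
    proof (rule search_machine_eq)
      show "out j = out i" if "D j" "code j = code i" for j
        using free[OF \<open>D i\<close> \<open>D j\<close>] that by simp
    qed fact
    from complexity_le[where M="?M", OF this] have "complexity ?M (str_of_nat (out i)) + enat c \<le> enat (Suc (k i)) + enat c"
      unfolding slen_code[OF that] by (rule add_right_mono)
    with c[of "str_of_nat (out i)"] show ?thesis by simp
  qed
  then show ?thesis by blast
qed

section \<open>Cylinders\<close>

definition cylinder :: "bool list \<Rightarrow> (nat \<Rightarrow> bool) set" where
  "cylinder \<sigma> = {X. restr X (length \<sigma>) = \<sigma>}"

lemma length_restr [simp]: "length (restr X n) = n"
  by (simp add: restr_def)

lemma restr_eq_iff: "restr X (length \<sigma>) = \<sigma> \<longleftrightarrow> (\<forall>i<length \<sigma>. X i = \<sigma> ! i)"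
  unfolding restr_def by (subst list_eq_iff_nth_eq) simp

lemma take_restr: "k \<le> n \<Longrightarrow> take k (restr X n) = restr X k"
  by (simp add: restr_def take_map)

lemma open_of_eq_cylinders: "open_of S = (\<Union>\<sigma>\<in>S. cylinder \<sigma>)"
proof (intro set_eqI iffI)
  fix X assume "X \<in> open_of S"
  then obtain n where "restr X n \<in> S" by (auto simp: open_of_def)
  moreover have "X \<in> cylinder (restr X n)" by (simp add: cylinder_def)
  ultimately show "X \<in> (\<Union>\<sigma>\<in>S. cylinder \<sigma>)" by blast
next
  fix X assume "X \<in> (\<Union>\<sigma>\<in>S. cylinder \<sigma>)"
  then obtain \<sigma> where "\<sigma> \<in> S" "restr X (length \<sigma>) = \<sigma>" by (auto simp: cylinder_def)
  then show "X \<in> open_of S" unfolding open_of_def by (auto intro!: exI[of _ "length \<sigma>"])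
qed

lemma prob_space_coin_measure: "prob_space coin_measure"
  unfolding coin_measure_def by (intro prob_space_PiM measure_pmf.prob_space_axioms)

lemma
  shows sets_cylinder: "cylinder \<sigma> \<in> sets coin_measure"
    and measure_cylinder: "measure coin_measure (cylinder \<sigma>) = (1/2) ^ length \<sigma>"
proof -
  let ?M = "\<lambda>_::nat. measure_pmf (bernoulli_pmf (1/2))"
  interpret product_prob_space ?M UNIV by unfold_locales
  have eq: "cylinder \<sigma> = {x \<in> space (PiM UNIV ?M). \<forall>i\<in>{..<length \<sigma>}. x i \<in> {\<sigma> ! i}}"
    by (auto simp: cylinder_def restr_eq_iff space_PiM)
  have "{x \<in> space (PiM UNIV ?M). \<forall>i\<in>{..<length \<sigma>}. x i \<in> {\<sigma> ! i}} \<in> sets (PiM UNIV ?M)"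
    by (intro sets.sets_Collect_finite_All sets_Collect_single) auto
  then show "cylinder \<sigma> \<in> sets coin_measure" by (simp only: eq coin_measure_def)
  have half: "emeasure (measure_pmf (bernoulli_pmf (1/2))) {b} = ennreal (1/2)" for b
    by (cases b) (simp_all add: emeasure_pmf_single)
  have "emeasure coin_measure (cylinder \<sigma>) = (\<Prod>i\<in>{..<length \<sigma>}. emeasure (?M i) {\<sigma> ! i})"
    unfolding eq coin_measure_def by (rule emeasure_PiM_Collect) auto
  also have "\<dots> = ennreal ((1/2) ^ length \<sigma>)"
    using ennreal_power[of "1/2" "length \<sigma>"] by (simp only: half prod_constant card_lessThan)
  finally show "measure coin_measure (cylinder \<sigma>) = (1/2) ^ length \<sigma>"
    by (simp add: measure_def)
qed

text \<open>Two prefixes of the same sequence are comparable.\<close>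

lemma disjoint_cylinders:
  assumes "\<not> prefix \<sigma> \<tau>" "\<not> prefix \<tau> \<sigma>" shows "cylinder \<sigma> \<inter> cylinder \<tau> = {}"
proof -
  have "prefix (restr X m) (restr X n)" if "m \<le> n" for X m n
    using take_restr[OF that, of X] by (metis take_is_prefix)
  then have "prefix \<sigma> \<tau> \<or> prefix \<tau> \<sigma>" if "X \<in> cylinder \<sigma>" "X \<in> cylinder \<tau>" for X
    using that by (metis (mono_tags) cylinder_def mem_Collect_eq nle_le)
  then show ?thesis using assms by blast
qed

lemma sets_open_of: "open_of S \<in> sets coin_measure"
  unfolding open_of_eq_cylinders by (rule sets.countable_UN'') (auto simp: sets_cylinder)

text \<open>The cylinders of a prefix-free set are disjoint, so its weight is the measure of their
  union. This serves both Kraft's inequality and the weight bound for the generators of a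
  test.\<close>

lemma prefix_free_weight_le_measure:
  assumes "finite F" "F \<subseteq> S" and free: "\<And>\<sigma> \<tau>. \<sigma> \<in> F \<Longrightarrow> \<tau> \<in> F \<Longrightarrow> prefix \<sigma> \<tau> \<Longrightarrow> \<sigma> = \<tau>"
  shows "(\<Sum>\<sigma>\<in>F. (1/2) ^ length \<sigma>) \<le> measure coin_measure (open_of S)"
proof -
  interpret prob_space coin_measure by (rule prob_space_coin_measure)
  have "disjoint_family_on cylinder F"
    unfolding disjoint_family_on_def using free disjoint_cylinders by blast
  then have "measure coin_measure (\<Union>\<sigma>\<in>F. cylinder \<sigma>) = (\<Sum>\<sigma>\<in>F. measure coin_measure (cylinder \<sigma>))"
    using assms(1) by (intro finite_measure_finite_Union) (auto simp: sets_cylinder)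
  then have "(\<Sum>\<sigma>\<in>F. (1/2) ^ length \<sigma>) = measure coin_measure (\<Union>\<sigma>\<in>F. cylinder \<sigma>)"
    by (simp add: measure_cylinder)
  also have "\<dots> \<le> measure coin_measure (open_of S)"
    using assms(2) by (intro finite_measure_mono sets_open_of) (auto simp: open_of_eq_cylinders)
  finally show ?thesis .
qed

lemma kraft_inequality:
  assumes "prefix_free_machine U" "finite F" "F \<subseteq> dom U"
  shows "(\<Sum>p\<in>F. (1/2) ^ length p) \<le> (1::real)"
proof -
  interpret prob_space coin_measure by (rule prob_space_coin_measure)
  have "(\<Sum>p\<in>F. (1/2) ^ length p) \<le> measure coin_measure (open_of F)"
    using assms unfolding prefix_free_machine_def
    by (intro prefix_free_weight_le_measure order_refl) blast+
  also have "\<dots> \<le> 1" by (rule prob_le_1)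
  finally show ?thesis .
qed

section \<open>Random sequences have complex prefixes\<close>

text \<open>Kraft's inequality is applied to one short program for each \<open>n\<close>. The
  programs are distinct because their outputs are, and the factor \<open>2 ^ c\<close> pays for the
  additive constant.\<close>

lemma complexity_upper_bound_weight:
  assumes U: "prefix_free_machine U"
    and g: "\<And>n. complexity U (str_of_nat n) \<le> enat (g n) + enat c"
  shows "(\<Sum>n<N. (1/2) ^ g n) \<le> (2::real) ^ c"
proof -
  have "\<exists>p. U p = Some (str_of_nat n) \<and> length p \<le> g n + c" for n
    using g[of n] complexity_attained[of U "str_of_nat n" "g n + c"] by auto
  then obtain p where p: "\<And>n. U (p n) = Some (str_of_nat n)" "\<And>n. length (p n) \<le> g n + c"
    by metis
  have inj: "inj_on p {..<N}"
    by (rule inj_onI) (metis p(1) nat_of_str_of_nat option.inject)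
  have "(\<Sum>n<N. (1/2) ^ g n) = (\<Sum>n<N. (2::real) ^ c * (1/2) ^ (g n + c))"
    by (intro sum.cong refl) (simp add: power_add power_divide)
  also have "\<dots> \<le> (\<Sum>n<N. 2 ^ c * (1/2) ^ length (p n))"
    by (intro sum_mono mult_left_mono power_decreasing p) simp_all
  also have "\<dots> = 2 ^ c * (\<Sum>q\<in>p ` {..<N}. (1/2) ^ length q)"
    by (simp add: sum.reindex[OF inj] sum_distrib_left)
  also have "\<dots> \<le> 2 ^ c * 1"
    using p(1) by (intro mult_left_mono kraft_inequality[OF U]) auto
  finally show ?thesis by simp
qed

lemma computable2_iff: "computable2 h \<longleftrightarrow> computable (\<lambda>z. h (pfst z) (psnd z))"
proof
  assume "computable2 h"
  then obtain \<phi> where \<phi>: "partrec \<phi>" "\<And>x t. \<phi> (prod_encode (x, t)) = Some (h x t)"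
    unfolding computable2_def by blast
  have "\<phi> = (\<lambda>z. Some (h (pfst z) (psnd z)))"
    using \<phi>(2)[of "pfst z" "psnd z" for z] by (simp add: fun_eq_iff)
  with \<phi>(1) show "computable (\<lambda>z. h (pfst z) (psnd z))" by (simp add: computable_def)
next
  assume "computable (\<lambda>z. h (pfst z) (psnd z))"
  then show "computable2 h" unfolding computable2_def computable_def by fastforce
qed

lemma right_ceE:
  assumes "right_ce g"
  obtains h where "computable (\<lambda>z. h (pfst z) (psnd z))" "\<And>n s t. s \<le> t \<Longrightarrow> h n t \<le> h n s"
    "\<And>n t. g n \<le> h n t" "\<And>n. eventually (\<lambda>t. h n t = g n) sequentially"
proof -
  obtain h where h: "computable2 h" "\<And>x. antimono (h x)" "\<And>x. h x \<longlonglongrightarrow> g x"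
    using assms unfolding right_ce_def by blast
  show ?thesis
  proof (rule that[of h])
    show "computable (\<lambda>z. h (pfst z) (psnd z))" using h(1) by (simp add: computable2_iff)
    show "h n t \<le> h n s" if "s \<le> t" for n s t using h(2) that by (blast dest: antimonoD)
    show "g n \<le> h n t" for n t using h(2,3) by (rule decseq_ge)
    show "eventually (\<lambda>t. h n t = g n) sequentially" for n
      using h(3)[of n] by (simp add: tendsto_discrete)
  qed
qed

text \<open>An unbounded search for a witness halts exactly on this set; the negation occurs because
  \<open>minimise\<close> looks for zeros.\<close>

lemma ce_set_exists:
  assumes "decidable (\<lambda>z. T (pfst z) (psnd z))"
  shows "ce_set {x. \<exists>y. T x y}"
proof -
  let ?\<phi> = "minimise (\<lambda>z. Some (of_bool (\<not> T (pfst z) (psnd z))))"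
  have "computable (\<lambda>z. of_bool (\<not> T (pfst z) (psnd z)))" by (intro computable_intros assms)
  then have "partrec ?\<phi>" by (intro partrec.mu) (simp add: computable_def)
  moreover have "{x. \<exists>y. T x y} = dom ?\<phi>" by (auto simp: minimise_def dom_def)
  ultimately show ?thesis unfolding ce_set_def by blast
qed

text \<open>There are fewer than \<open>2 ^ k\<close> programs shorter than \<open>k\<close>, and
  each describes at most one string.\<close>

lemma card_described_le:
  fixes M :: machine
  assumes "\<And>\<sigma>. \<sigma> \<in> S \<Longrightarrow> \<exists>p. M p = Some \<sigma> \<and> length p < k"
  shows "finite S \<and> card S \<le> 2 ^ k"
proof -
  obtain p where p: "\<And>\<sigma>. \<sigma> \<in> S \<Longrightarrow> M (p \<sigma>) = Some \<sigma> \<and> length (p \<sigma>) < k"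
    using assms by metis
  have inj: "inj_on (\<lambda>\<sigma>. nat_of_str (p \<sigma>)) S"
    by (rule inj_onI) (metis p inj_nat_of_str option.inject)
  have sub: "(\<lambda>\<sigma>. nat_of_str (p \<sigma>)) ` S \<subseteq> {..<2 ^ k}"
  proof clarsimp
    fix \<sigma> assume "\<sigma> \<in> S"
    then have "Suc (length (p \<sigma>)) \<le> k" using p[of \<sigma>] by simp
    then have "(2::nat) ^ Suc (length (p \<sigma>)) \<le> 2 ^ k" by (intro power_increasing) simp_all
    moreover have "Suc (nat_of_str (p \<sigma>)) < 2 ^ Suc (length (p \<sigma>))" by (rule nat_of_str_bounds)
    ultimately show "nat_of_str (p \<sigma>) < 2 ^ k" by linarith
  qed
  have "finite S" using inj_on_finite[OF inj sub] by simp
  with card_inj_on_le[OF inj sub] show ?thesis by simp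
qed

theorem ml_random_imp_complex:
  assumes U: "prefix_free_machine U" and V: "plain_machine V" and g: "right_ce g"
    and upper: "\<And>n. complexity U (str_of_nat n) \<le> enat (g n) + enat d"
    and random: "ml_random A"
  shows "\<exists>c::nat. \<forall>n. enat n \<le> complexity V (restr A n) + enat (g n) + enat c"
proof (rule ccontr)
  assume simple: "\<not> ?thesis"
  \<comment> \<open>The summand \<open>d\<close> compensates for the Kraft sum of \<open>g\<close>,
    which is only bounded by \<open>2 ^ d\<close>.\<close>
  define W where "W m = {\<sigma>. \<exists>p. V p = Some \<sigma> \<and> length p + g (length \<sigma>) + m + d < length \<sigma>}" for m
  have A: "A \<in> open_of (W m)" for m
  proof -
    obtain n where n: "\<not> enat n \<le> complexity V (restr A n) + enat (g n) + enat (m + d)"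
      using simple by blast
    then obtain k where k: "complexity V (restr A n) = enat k"
      by (cases "complexity V (restr A n)") auto
    then obtain p where "V p = Some (restr A n)" "length p \<le> k"
      using complexity_attained[of V "restr A n" k] by auto
    then have "restr A n \<in> W m" using n k by (auto simp: W_def)
    then show ?thesis by (auto simp: open_of_def)
  qed
  have "ml_test W"
    unfolding ml_test_def
  proof (intro conjI allI)
    obtain h where h: "computable (\<lambda>z. h (pfst z) (psnd z))" "\<And>n t. g n \<le> h n t"
        "\<And>n. eventually (\<lambda>t. h n t = g n) sequentially"
      using right_ceE[OF g] by metis
    have h_comp: "computable (\<lambda>x. h (f1 x) (f2 x))" if "computable f1" "computable f2" for f1 f2
      using computable_compose[OF h(1) computable_pair[OF that]] by simp
    obtain \<phi> where \<phi>: "partrec \<phi>" "\<And>p. \<phi> (nat_of_str p) = map_option nat_of_str (V p)"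
      using V unfolding plain_machine_def by blast
    obtain F where F: "approximates F \<phi>" using partrec_approximation[OF \<phi>(1)] by blast
    \<comment> \<open>A witness \<open>y\<close> codes a program, a number of steps and a stage of
      \<open>h\<close>. Since \<open>h\<close> reaches \<open>g\<close> from above, the inequality
      holds for \<open>g\<close> if and only if it holds at some stage.\<close>
    define T where "T x y \<longleftrightarrow> F (pfst y) (pfst (psnd y)) = Suc (psnd x) \<and>
      slen (pfst y) + h (slen (psnd x)) (psnd (psnd y)) + pfst x + d < slen (psnd x)" for x y
    have "decidable (\<lambda>z. T (pfst z) (psnd z))"
      unfolding T_def by (intro computable_intros approximates_computable[OF F] h_comp)
    then have "ce_set {x. \<exists>y. T x y}" by (rule ce_set_exists)
    also have "{x. \<exists>y. T x y} = {prod_encode (m, nat_of_str \<sigma>) |m \<sigma>. \<sigma> \<in> W m}"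
    proof (intro set_eqI iffI)
      fix x assume "x \<in> {x. \<exists>y. T x y}"
      then obtain y where y: "T x y" by blast
      let ?p = "str_of_nat (pfst y)" and ?\<sigma> = "str_of_nat (psnd x)"
      have "\<phi> (nat_of_str ?p) = Some (psnd x)" 
        by (rule approximates_sound[OF F, of _ "pfst (psnd y)"]) (use y in \<open>simp add: T_def\<close>)
      then have "V ?p = Some ?\<sigma>" unfolding \<phi>(2) by (auto dest: arg_cong[of _ _ str_of_nat])
      moreover have "length ?p + g (length ?\<sigma>) + pfst x + d < length ?\<sigma>"
        using y h(2)[of "length ?\<sigma>" "psnd (psnd y)"] unfolding T_def by linarith
      ultimately have "?\<sigma> \<in> W (pfst x)" unfolding W_def by blast
      moreover have "x = prod_encode (pfst x, nat_of_str ?\<sigma>)" by simp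
      ultimately show "x \<in> {prod_encode (m, nat_of_str \<sigma>) |m \<sigma>. \<sigma> \<in> W m}" by blast
    next
      fix x assume "x \<in> {prod_encode (m, nat_of_str \<sigma>) |m \<sigma>. \<sigma> \<in> W m}"
      then obtain m \<sigma> p where x: "x = prod_encode (m, nat_of_str \<sigma>)" and p: "V p = Some \<sigma>"
          and len: "length p + g (length \<sigma>) + m + d < length \<sigma>"
        by (auto simp: W_def)
      have "\<phi> (nat_of_str p) = Some (nat_of_str \<sigma>)" by (simp add: \<phi>(2) p)
      from approximates_complete[OF F this] obtain s where "F (nat_of_str p) s = Suc (nat_of_str \<sigma>)"
        by (auto simp: eventually_sequentially)
      moreover obtain t where "h (length \<sigma>) t = g (length \<sigma>)"
        using h(3)[of "length \<sigma>"] by (auto simp: eventually_sequentially)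
      ultimately have "T x (prod_encode (nat_of_str p, prod_encode (s, t)))"
        using len by (simp add: T_def x)
      then show "x \<in> {x. \<exists>y. T x y}" by blast
    qed
    finally show "ce_set {prod_encode (m, nat_of_str \<sigma>) |m \<sigma>. \<sigma> \<in> W m}" .
  next
    fix m
    interpret prob_space coin_measure by (rule prob_space_coin_measure)
    \<comment> \<open>The level is split by length. Length \<open>n\<close> contributes at most
      \<open>2 ^ l\<close> cylinders of measure \<open>2^(-n)\<close> with
      \<open>n - l = g n + m + d\<close>, and nothing if \<open>n\<close> is too small.\<close>
    define P where "P n = open_of {\<sigma> \<in> W m. length \<sigma> = n}" for n
    have P_le: "measure coin_measure (P n) \<le> (1/2) ^ (g n + m + d)" for n
    proof (cases "g n + m + d < n")
      case False
      then have "{\<sigma> \<in> W m. length \<sigma> = n} = {}" by (auto simp: W_def)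
      then show ?thesis by (simp only: P_def open_of_eq_cylinders) simp
    next
      case True
      define l where "l = n - (g n + m + d)"
      let ?S = "{\<sigma> \<in> W m. length \<sigma> = n}"
      have S: "finite ?S \<and> card ?S \<le> 2 ^ l"
        by (rule card_described_le[of _ V]) (auto simp: W_def l_def)
      have "measure coin_measure (P n) \<le> (\<Sum>\<sigma>\<in>?S. measure coin_measure (cylinder \<sigma>))"
        unfolding P_def open_of_eq_cylinders using S
        by (intro finite_measure_subadditive_finite) (auto simp: sets_cylinder)
      also have "\<dots> = card ?S * (1/2) ^ n" by (simp add: measure_cylinder)
      also have "\<dots> \<le> 2 ^ l * (1/2) ^ n"
        using S by (intro mult_right_mono) simp_all
      also have "\<dots> = (1/2) ^ (g n + m + d)"
      proof -
        have "n = l + (g n + m + d)" using True by (simp add: l_def)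
        then have "(1/2::real) ^ n = (1/2) ^ l * (1/2) ^ (g n + m + d)" by (metis power_add)
        then have "(2::real) ^ l * (1/2) ^ n = (2 ^ l * (1/2) ^ l) * (1/2) ^ (g n + m + d)"
          by (simp only: mult.assoc)
        moreover have "(2::real) ^ l * (1/2) ^ l = 1" by (simp add: power_divide)
        ultimately show ?thesis by (simp only: mult_1_left)
      qed
      finally show ?thesis .
    qed
    have partial: "(\<Sum>n<N. measure coin_measure (P n)) \<le> (1/2) ^ m" for N
    proof -
      have "(\<Sum>n<N. measure coin_measure (P n)) \<le> (\<Sum>n<N. (1/2) ^ (m + d) * (1/2) ^ g n)"
        by (intro sum_mono order_trans[OF P_le]) (simp add: power_add mult_ac)
      also have "\<dots> = (1/2) ^ (m + d) * (\<Sum>n<N. (1/2) ^ g n)" by (simp only: sum_distrib_left)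
      also have "\<dots> \<le> (1/2) ^ (m + d) * 2 ^ d"
        using complexity_upper_bound_weight[OF U upper] by (intro mult_left_mono) simp_all
      also have "\<dots> = (1/2) ^ m" by (simp add: power_add power_divide)
      finally show ?thesis .
    qed
    have summable: "summable (\<lambda>n. measure coin_measure (P n))"
      by (rule summableI_nonneg_bounded[OF _ partial]) simp
    have "open_of (W m) = (\<Union>n. P n)" by (auto simp: P_def open_of_def)
    also have "measure coin_measure \<dots> \<le> (\<Sum>n. measure coin_measure (P n))"
      using summable by (intro finite_measure_subadditive_countably) (auto simp: P_def sets_open_of)
    also have "\<dots> \<le> (1/2) ^ m"
      by (rule suminf_le_const[OF summable partial])
    finally show "measure coin_measure (open_of (W m)) \<le> (1/2) ^ m" .
  qed
  with A random show False unfolding ml_random_def by blast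
qed

section \<open>Decidable prefix-free generators of a test\<close>

text \<open>With a leading one in front of the string, dividing by a power of two cuts off the last
  digits.\<close>

lemma Suc_nat_of_str_append_div: "Suc (nat_of_str (\<sigma> @ \<rho>)) div 2 ^ length \<rho> = Suc (nat_of_str \<sigma>)"
proof -
  obtain w where w: "Suc (nat_of_str \<rho>) = 2 ^ length \<rho> + w" "w < 2 ^ length \<rho>"
  proof (rule that)
    show "Suc (nat_of_str \<rho>) = 2 ^ length \<rho> + (Suc (nat_of_str \<rho>) - 2 ^ length \<rho>)"
      "Suc (nat_of_str \<rho>) - 2 ^ length \<rho> < 2 ^ length \<rho>"
      using nat_of_str_bounds[of \<rho>] by simp_all
  qed
  have "Suc (nat_of_str (\<sigma> @ \<rho>)) = w + Suc (nat_of_str \<sigma>) * 2 ^ length \<rho>"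
    using w(1) by (simp add: nat_of_str_append)
  then show ?thesis using w(2) by (simp del: mult_Suc)
qed

lemma nat_of_str_take:
  assumes "e \<le> length \<sigma>"
  shows "nat_of_str (take (length \<sigma> - e) \<sigma>) = Suc (nat_of_str \<sigma>) div 2 ^ e - 1"
  using Suc_nat_of_str_append_div[of "take (length \<sigma> - e) \<sigma>" "drop (length \<sigma> - e) \<sigma>"] assms by simp

lemma str_of_nat_parent: "n > 0 \<Longrightarrow> str_of_nat ((n - 1) div 2) = butlast (str_of_nat n)"
  by (cases n) auto

text \<open>Enumeration is replaced by delay: \<open>Q\<close> holds for a string once one of its
  prefixes has been enumerated within a number of steps at most its own length. This is decidable
  and passes to extensions, so its minimal strings form a decidable prefix-free set.\<close>

lemma ml_test_decidable_generators:
  assumes "ml_test W"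
  obtains Z :: "nat \<Rightarrow> nat \<Rightarrow> bool" where
    "decidable (\<lambda>z. Z (pfst z) (psnd z))"
    "\<And>m F. finite F \<Longrightarrow> (\<And>i. i \<in> F \<Longrightarrow> Z m i) \<Longrightarrow> (\<Sum>i\<in>F. (1/2) ^ slen i) \<le> (1/2 :: real) ^ m"
    "\<And>m X. X \<in> open_of (W m) \<Longrightarrow> \<exists>n. Z m (nat_of_str (restr X n))"
proof -
  obtain \<phi> where \<phi>: "partrec \<phi>" "{prod_encode (m, nat_of_str \<sigma>) |m \<sigma>. \<sigma> \<in> W m} = dom \<phi>"
    using assms unfolding ml_test_def ce_set_def by blast
  obtain F where F: "approximates F \<phi>" using partrec_approximation[OF \<phi>(1)] by blast
  have dom: "prod_encode (m, nat_of_str \<sigma>) \<in> dom \<phi> \<longleftrightarrow> \<sigma> \<in> W m" for m \<sigma>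
    unfolding \<phi>(2)[symmetric] by (auto simp: inj_nat_of_str)
  define Q where "Q m \<sigma> \<longleftrightarrow>
    (\<exists>k\<le>length \<sigma>. \<exists>s\<le>length \<sigma>. F (prod_encode (m, nat_of_str (take k \<sigma>))) s \<noteq> 0)" for m \<sigma>
  define Z where "Z m i \<longleftrightarrow> Q m (str_of_nat i) \<and> (i = 0 \<or> \<not> Q m (str_of_nat ((i - 1) div 2)))" for m i
  have Q_mono: "Q m \<tau>" if "Q m \<sigma>" "prefix \<sigma> \<tau>" for m \<sigma> \<tau>
  proof -
    obtain k s where ks: "k \<le> length \<sigma>" "s \<le> length \<sigma>" "F (prod_encode (m, nat_of_str (take k \<sigma>))) s \<noteq> 0"
      using \<open>Q m \<sigma>\<close> unfolding Q_def by blast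
    moreover have "take k \<tau> = take k \<sigma>" using that(2) ks(1) by (auto simp: prefix_def)
    moreover have "length \<sigma> \<le> length \<tau>" using that(2) by (rule prefix_length_le)
    ultimately show ?thesis unfolding Q_def by (metis le_trans)
  qed
  have Q_sound: "\<exists>k. take k \<sigma> \<in> W m" if "Q m \<sigma>" for m \<sigma>
  proof -
    obtain k s where "F (prod_encode (m, nat_of_str (take k \<sigma>))) s \<noteq> 0"
      using \<open>Q m \<sigma>\<close> unfolding Q_def by blast
    then obtain y where "F (prod_encode (m, nat_of_str (take k \<sigma>))) s = Suc y"
      using not0_implies_Suc by blast
    then have "prod_encode (m, nat_of_str (take k \<sigma>)) \<in> dom \<phi>"
      using approximates_sound[OF F] by blast
    then show ?thesis unfolding dom by blast
  qed
  have free: "i = j" if "Z m i" "Z m j" "prefix (str_of_nat i) (str_of_nat j)" for m i j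
  proof (rule ccontr)
    assume "i \<noteq> j"
    then have "str_of_nat i \<noteq> str_of_nat j" by (metis nat_of_str_of_nat)
    with that(3) obtain b \<rho> where \<rho>: "str_of_nat j = str_of_nat i @ \<rho> @ [b]"
      by (metis append_Nil2 prefix_def rev_exhaust)
    then have "j > 0" by (cases j) auto
    have "prefix (str_of_nat i) (str_of_nat ((j - 1) div 2))"
      unfolding str_of_nat_parent[OF \<open>j > 0\<close>] \<rho> by (simp add: butlast_append)
    then have "Q m (str_of_nat ((j - 1) div 2))" using that(1) Q_mono unfolding Z_def by blast
    then show False using that(2) \<open>j > 0\<close> unfolding Z_def by simp
  qed
  show ?thesis
  proof (rule that[of Z])
    \<comment> \<open>Prefixes are obtained by division of the string's number, which brings
      \<open>Q\<close> into a form covered by the computability rules.\<close>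
    have Q_iff: "Q m (str_of_nat i) \<longleftrightarrow>
      (\<exists>e\<le>slen i. \<exists>s\<le>slen i. F (prod_encode (m, Suc i div 2 ^ e - 1)) s \<noteq> 0)" for m i
    proof -
      have reverse: "(\<exists>k\<le>l. P k) \<longleftrightarrow> (\<exists>e\<le>l. P (l - e))" for P and l :: nat
      proof
        assume "\<exists>k\<le>l. P k"
        then obtain k where "k \<le> l" "P k" by blast
        then show "\<exists>e\<le>l. P (l - e)" by (intro exI[of _ "l - k"]) simp
      next
        assume "\<exists>e\<le>l. P (l - e)"
        then obtain e where "e \<le> l" "P (l - e)" by blast
        then show "\<exists>k\<le>l. P k" by (intro exI[of _ "l - e"]) simp
      qed
      have "Q m (str_of_nat i) \<longleftrightarrow> (\<exists>e\<le>slen i. \<exists>s\<le>slen i.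
          F (prod_encode (m, nat_of_str (take (slen i - e) (str_of_nat i)))) s \<noteq> 0)"
        unfolding Q_def by (rule reverse)
      then show ?thesis using nat_of_str_take[of _ "str_of_nat i"] by (simp cong: conj_cong)
    qed
    show "decidable (\<lambda>z. Z (pfst z) (psnd z))"
      unfolding Z_def Q_iff by (intro computable_intros approximates_computable[OF F])
  next
    fix m and I :: "nat set" assume I: "finite I" "\<And>i. i \<in> I \<Longrightarrow> Z m i"
    interpret prob_space coin_measure by (rule prob_space_coin_measure)
    have inj: "inj_on str_of_nat I" by (rule inj_onI) (metis nat_of_str_of_nat)
    have "(\<Sum>i\<in>I. (1/2) ^ slen i) = (\<Sum>\<sigma>\<in>str_of_nat ` I. (1/2 :: real) ^ length \<sigma>)"
      by (simp add: sum.reindex[OF inj])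
    also have "\<dots> \<le> measure coin_measure (open_of (str_of_nat ` I))"
    proof (rule prefix_free_weight_le_measure)
      fix \<sigma> \<tau> assume "\<sigma> \<in> str_of_nat ` I" "\<tau> \<in> str_of_nat ` I" "prefix \<sigma> \<tau>"
      then show "\<sigma> = \<tau>" using I(2) free[of m] by blast
    qed (use I(1) in simp_all)
    also have "\<dots> \<le> measure coin_measure (open_of (W m))"
    proof (intro finite_measure_mono sets_open_of subsetI)
      fix X assume "X \<in> open_of (str_of_nat ` I)"
      then obtain n i where "i \<in> I" and X: "restr X n = str_of_nat i" by (auto simp: open_of_def)
      then have "Q m (restr X n)" using I(2) by (auto simp: Z_def)
      then obtain k where "take k (restr X n) \<in> W m" using Q_sound by blast
      moreover have "take k (restr X n) = restr X (min k n)" by (simp add: restr_def take_map min_def)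
      ultimately show "X \<in> open_of (W m)" by (auto simp: open_of_def)
    qed
    also have "\<dots> \<le> (1/2) ^ m" using assms by (simp add: ml_test_def)
    finally show "(\<Sum>i\<in>I. (1/2) ^ slen i) \<le> (1/2 :: real) ^ m" .
  next
    fix m X assume "X \<in> open_of (W m)"
    then obtain n where "restr X n \<in> W m" by (auto simp: open_of_def)
    then obtain y where "\<phi> (prod_encode (m, nat_of_str (restr X n))) = Some y"
      unfolding dom[symmetric] by blast
    from approximates_complete[OF F this] obtain s where "F (prod_encode (m, nat_of_str (restr X n))) s = Suc y"
      by (auto simp: eventually_sequentially)
    then have "Q m (restr X (max n s))"
      unfolding Q_def by (intro exI[of _ n] conjI exI[of _ s]) (simp_all add: take_restr)
    \<comment> \<open>The prefix of length \<open>max n s\<close> satisfies \<open>Q\<close>; the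
      shortest such prefix is minimal and hence in \<open>Z\<close>.\<close>
    define N where "N = (LEAST N. Q m (restr X N))"
    have QN: "Q m (restr X N)" unfolding N_def by (rule LeastI) fact
    have "Z m (nat_of_str (restr X N))"
    proof (cases N)
      case 0
      then show ?thesis using QN by (simp add: Z_def restr_def nat_of_str_def)
    next
      case (Suc M)
      have "\<not> Q m (restr X M)" using not_less_Least[of M "\<lambda>N. Q m (restr X N)"] Suc by (simp add: N_def)
      moreover have "butlast (restr X N) = restr X M" by (simp add: Suc restr_def)
      moreover have "nat_of_str (restr X N) > 0"
        by (rule gr0I) (metis Suc Zero_not_Suc length_restr list.size(3) str_of_nat.simps(1) str_of_nat_of_str)
      ultimately show ?thesis using QN str_of_nat_parent[of "nat_of_str (restr X N)"] by (simp add: Z_def)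
    qed
    then show "\<exists>n. Z m (nat_of_str (restr X n))" by blast
  qed
qed

section \<open>The construction\<close>

text \<open>
  The number \<open>r\<close> is the desired gain. Codes save \<open>2r\<close> bits, of which the prefix that makes \<open>r\<close> known
  to the machine costs \<open>r\<close>; requests save \<open>r\<close> bits. Taking the test at level \<open>4r + 2\<close> makes the
  requests for \<open>r\<close> have weight at most \<open>2^(-r-1)\<close>. The condition \<open>2k \<le> n\<close> is harmless since
  \<open>K(n) \<le> n/3 + O(1)\<close>; together with the lower bound on \<open>n\<close> it forces code lengths beyond \<open>T\<close>.
\<close>

locale compression =
  fixes h :: "nat \<Rightarrow> nat \<Rightarrow> nat" and Z :: "nat \<Rightarrow> nat \<Rightarrow> bool"
  assumes h_computable: "computable (\<lambda>z. h (pfst z) (psnd z))"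
    and h_antimono: "\<And>n s t. s \<le> t \<Longrightarrow> h n t \<le> h n s"
    and Z_decidable: "decidable (\<lambda>z. Z (pfst z) (psnd z))"
    and Z_weight: "\<And>r F. finite F \<Longrightarrow> (\<And>i. i \<in> F \<Longrightarrow> Z r i) \<Longrightarrow>
      (\<Sum>i\<in>F. (1/2) ^ slen i) \<le> (1/2 :: real) ^ (4 * r + 2)"
begin

definition active :: "nat \<Rightarrow> nat \<Rightarrow> nat \<Rightarrow> nat \<Rightarrow> nat \<Rightarrow> bool" where
  "active r T t n k \<longleftrightarrow> 2 * (T + 2 * r) < n \<and> n \<le> t \<and> 2 * k \<le> n \<and> h n t \<le> k"

text \<open>\<open>l\<close> and \<open>k\<close> determine each other by
  \<open>n = l + k + 2 * r\<close>: codes of length \<open>l\<close> for strings of length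
  \<open>n\<close> save \<open>k + 2 * r\<close> bits.\<close>

definition usable :: "nat \<Rightarrow> nat \<Rightarrow> nat \<Rightarrow> nat \<Rightarrow> nat \<Rightarrow> bool" where
  "usable r T t l n \<longleftrightarrow> l + 2 * r \<le> n \<and> active r T t n (n - l - 2 * r)"

text \<open>The one length \<open>n\<close> that receives codes of length \<open>l\<close>; the
  value \<open>Suc t\<close> means that there is none.\<close>

definition first :: "nat \<Rightarrow> nat \<Rightarrow> nat \<Rightarrow> nat \<Rightarrow> nat" where
  "first r T t l = bounded_least (Suc t) (usable r T t l)"

text \<open>Space is counted in strings of length \<open>t\<close>: each of \<open>2 ^ l\<close>
  codes stands for a string of length \<open>n = first r T t l\<close>, which has
  \<open>2 ^ (t - n)\<close> extensions of length \<open>t\<close>.\<close>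

definition capacity :: "nat \<Rightarrow> nat \<Rightarrow> nat \<Rightarrow> nat \<Rightarrow> nat" where
  "capacity r T t l = (if first r T t l \<le> t then 2 ^ (t + l - first r T t l) else 0)"

text \<open>Besides the space provided by code lengths below \<open>l\<close>, this is the offset in
  the cylinder at which the share of code length \<open>l\<close> begins.\<close>

definition total :: "nat \<Rightarrow> nat \<Rightarrow> nat \<Rightarrow> nat \<Rightarrow> nat" where
  "total r T t l = (\<Sum>l'<l. capacity r T t l')"

text \<open>\<open>2 ^ (t - slen i)\<close> is the size of the cylinder of string number
  \<open>i\<close>, counted in strings of length \<open>t\<close>.\<close>

definition covered :: "nat \<Rightarrow> nat \<Rightarrow> nat \<Rightarrow> nat \<Rightarrow> bool" where
  "covered r T t i \<longleftrightarrow> 2 ^ (t - slen i) \<le> total r T t (Suc t)"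

text \<open>A pair of the string being treated and the time at which its phase began. A number
  outside \<open>Z\<close> takes one step and is passed over.\<close>

definition state :: "nat \<Rightarrow> nat \<Rightarrow> nat" where
  "state r t = rec_nat (prod_encode (0, 0))
     (\<lambda>t y. if Z r (pfst y) \<and> \<not> covered r (psnd y) t (pfst y) then y else prod_encode (Suc (pfst y), Suc t)) t"

definition phase :: "nat \<Rightarrow> nat \<Rightarrow> nat" where "phase r t = pfst (state r t)"
definition start :: "nat \<Rightarrow> nat \<Rightarrow> nat" where "start r t = psnd (state r t)"

definition waiting :: "nat \<Rightarrow> nat \<Rightarrow> bool" where
  "waiting r t \<longleftrightarrow> Z r (phase r t) \<and> \<not> covered r (start r t) t (phase r t)"

definition succeeding :: "nat \<Rightarrow> nat \<Rightarrow> bool" where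
  "succeeding r t \<longleftrightarrow> Z r (phase r t) \<and> covered r (start r t) t (phase r t)"

definition requested :: "nat \<Rightarrow> nat \<Rightarrow> nat \<Rightarrow> bool" where
  "requested r n k \<longleftrightarrow> (\<exists>t. waiting r t \<and> active r (start r t) t n k)"

section \<open>Computability of the construction\<close>

lemma computable_h:
  assumes "computable f" "computable g" shows "computable (\<lambda>x. h (f x) (g x))"
  using computable_compose[OF h_computable computable_pair[OF assms]] by simp

lemma decidable_Z:
  assumes "computable f" "computable g" shows "decidable (\<lambda>x. Z (f x) (g x))"
  using decidable_compose[OF Z_decidable computable_pair[OF assms]] by simp

lemma decidable_active:
  assumes "computable r" "computable T" "computable t" "computable n" "computable k"
  shows "decidable (\<lambda>x. active (r x) (T x) (t x) (n x) (k x))"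
  unfolding active_def by (intro computable_intros computable_h assms)

lemma decidable_usable:
  assumes "computable r" "computable T" "computable t" "computable l" "computable n"
  shows "decidable (\<lambda>x. usable (r x) (T x) (t x) (l x) (n x))"
  unfolding usable_def by (intro computable_intros decidable_active assms)

lemma computable_first:
  assumes "computable r" "computable T" "computable t" "computable l"
  shows "computable (\<lambda>x. first (r x) (T x) (t x) (l x))"
  unfolding first_def
  by (intro computable_intros decidable_usable assms assms[THEN computable_compose])

lemma computable_capacity:
  assumes "computable r" "computable T" "computable t" "computable l"
  shows "computable (\<lambda>x. capacity (r x) (T x) (t x) (l x))"
  unfolding capacity_def by (intro computable_intros computable_first assms)

lemma computable_total:
  assumes "computable r" "computable T" "computable t" "computable l"
  shows "computable (\<lambda>x. total (r x) (T x) (t x) (l x))"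
  unfolding total_def
  by (intro computable_intros computable_capacity assms assms[THEN computable_compose])

lemma decidable_covered:
  assumes "computable r" "computable T" "computable t" "computable i"
  shows "decidable (\<lambda>x. covered (r x) (T x) (t x) (i x))"
  unfolding covered_def by (intro computable_intros computable_total assms)

lemma computable_state:
  assumes "computable r" "computable t" shows "computable (\<lambda>x. state (r x) (t x))"
  unfolding state_def
  by (intro computable_intros decidable_Z decidable_covered assms assms[THEN computable_compose])

lemma computable_phase:
  assumes "computable r" "computable t" shows "computable (\<lambda>x. phase (r x) (t x))"
  unfolding phase_def by (intro computable_intros computable_state assms)

lemma computable_start:
  assumes "computable r" "computable t" shows "computable (\<lambda>x. start (r x) (t x))"
  unfolding start_def by (intro computable_intros computable_state assms)

lemma decidable_waiting:
  assumes "computable r" "computable t" shows "decidable (\<lambda>x. waiting (r x) (t x))"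
  unfolding waiting_def
  by (intro computable_intros decidable_Z decidable_covered computable_phase computable_start assms)

lemma decidable_succeeding:
  assumes "computable r" "computable t" shows "decidable (\<lambda>x. succeeding (r x) (t x))"
  unfolding succeeding_def
  by (intro computable_intros decidable_Z decidable_covered computable_phase computable_start assms)

subsection \<open>Phases\<close>

lemma state_Suc:
  "phase r (Suc t) = (if waiting r t then phase r t else Suc (phase r t))"
  "start r (Suc t) = (if waiting r t then start r t else Suc t)"
  by (simp_all add: phase_def start_def waiting_def state_def)

lemma phase_le_start: "phase r t \<le> start r t \<and> start r t \<le> t"
proof (induction t)
  case 0
  show ?case by (simp add: phase_def start_def state_def)
qed (auto simp: state_Suc)

lemma start_mono: "s \<le> t \<Longrightarrow> start r s \<le> start r t"
  by (rule lift_Suc_mono_le[of "start r"])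
    (use phase_le_start in \<open>auto simp: state_Suc le_SucI\<close>)

lemma phase_mono: "s \<le> t \<Longrightarrow> phase r s \<le> phase r t"
  by (rule lift_Suc_mono_le[of "phase r"]) (auto simp: state_Suc)

lemma start_eq_of_phase_eq:
  assumes "s \<le> t" "phase r s = phase r t"
  shows "start r s = start r t"
  using assms
proof (induction t rule: dec_induct)
  case (step t)
  then have "phase r (Suc t) = phase r t"
    using phase_mono[of s t r] phase_mono[of t "Suc t" r] by simp
  then have "waiting r t" by (simp add: state_Suc split: if_splits)
  then show ?case using step by (simp add: state_Suc)
qed simp

lemma start_after_success:
  assumes "succeeding r s" "s < t" shows "s < start r t"
proof -
  have "\<not> waiting r s" using assms(1) by (simp add: succeeding_def waiting_def)
  then have "start r (Suc s) = Suc s" by (simp add: state_Suc)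
  with start_mono[of "Suc s" t r] assms(2) show ?thesis by simp
qed

text \<open>As all lengths used in a phase exceed its start, they also exceed the length of the
  string treated.\<close>

lemma slen_phase_le: "slen (phase r t) \<le> start r t"
  using slen_le[of "phase r t"] phase_le_start[of r t] by linarith

text \<open>
  Code lengths used in different phases are different: a code length exceeds the start of its
  phase, but not its end.
\<close>

lemma usable_bounds:
  assumes "usable r T t l n"
  shows "T < l" "l \<le> n" "n \<le> t" "T < n"
proof -
  \<comment> \<open>With \<open>k = n - l - 2 * r\<close> at most half of \<open>n\<close>, the code
    length \<open>l\<close> is at least \<open>n/2 - 2 * r\<close>, which exceeds
    \<open>T\<close>.\<close>
  have "l + 2 * r \<le> n" "2 * T + 4 * r < n" "n \<le> t" "2 * (n - l - 2 * r) \<le> n"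
    using assms by (simp_all add: usable_def active_def)
  then show "T < l" "l \<le> n" "n \<le> t" "T < n" by linarith+
qed

lemma first_usable:
  assumes "first r T t l \<le> t" shows "usable r T t l (first r T t l)"
  using bounded_least_less[of "Suc t" "usable r T t l"] assms by (simp add: first_def)

lemma first_le: "usable r T t l n \<Longrightarrow> first r T t l \<le> n"
  unfolding first_def by (rule bounded_least_minimal)

subsection \<open>The weight of the requests\<close>

lemma geometric_interval: "(\<Sum>n\<in>{f..t}. (1/2) ^ n) \<le> 2 * (1/2 :: real) ^ f"
proof -
  have "(\<Sum>n\<in>{f..<f + d}. (1/2) ^ n) = 2 * (1/2 :: real) ^ f - 2 * (1/2) ^ (f + d)" for d
    by (induction d) (simp_all add: power_add)
  from this[of "Suc t - f"] show ?thesis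
    by (cases "f \<le> t") (simp_all add: atLeastLessThanSuc_atLeastAtMost)
qed

text \<open>
  For a fixed code length the weights \<open>2^(-k)\<close> of its pairs \<open>(n, k)\<close> decrease geometrically in \<open>n\<close>,
  so the least \<open>n\<close>, to which alone codes are given, carries at least half of their weight.
\<close>

lemma active_weight:
  assumes "finite R" "\<And>n k. (n, k) \<in> R \<Longrightarrow> active r T t n k"
  shows "(\<Sum>(n, k)\<in>R. (1/2) ^ k) \<le> 2 * 4 ^ r * (1/2 :: real) ^ t * total r T t (Suc t)"
proof -
  \<comment> \<open>Pairs are indexed by code length and \<open>n\<close>; \<open>bound\<close>
    makes the subtraction exact, so nothing is lost.\<close>
  define f where "f = (\<lambda>(n, k). (n - k - 2 * r, n))"
  have bound: "k + 2 * r \<le> n" if "(n, k) \<in> R" for n k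
  proof -
    have "2 * T + 4 * r < n" "2 * k \<le> n" using assms(2)[OF that] by (simp_all add: active_def)
    then show ?thesis by linarith
  qed
  have inj: "inj_on f R"
    by (rule inj_onI) (auto simp: f_def dest!: bound)
  define L where "L = (SIGMA l:{..t}. {n. n \<le> t \<and> usable r T t l n})"
  have sub: "f ` R \<subseteq> L"
  proof (rule image_subsetI)
    fix p assume "p \<in> R"
    moreover obtain n k where p: "p = (n, k)" by (cases p)
    ultimately have nk: "(n, k) \<in> R" by simp
    have u: "usable r T t (n - k - 2 * r) n"
      using assms(2)[OF nk] bound[OF nk] by (simp add: usable_def)
    have "n \<le> t" by (rule usable_bounds(3)[OF u])
    moreover have "n - k - 2 * r \<le> t" using usable_bounds(2)[OF u] calculation by (rule le_trans)
    ultimately show "f p \<in> L" using u by (simp add: f_def L_def p)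
  qed
  have "finite L" unfolding L_def by auto
  have "(\<Sum>(n, k)\<in>R. (1/2) ^ k) = (\<Sum>(l, n)\<in>f ` R. (1/2 :: real) ^ (n - l - 2 * r))"
    unfolding sum.reindex[OF inj] by (intro sum.cong) (auto simp: f_def dest!: bound)
  also have "\<dots> \<le> (\<Sum>(l, n)\<in>L. (1/2) ^ (n - l - 2 * r))"
    using \<open>finite L\<close> sub by (intro sum_mono2) auto
  also have "\<dots> = (\<Sum>l\<le>t. \<Sum>n | n \<le> t \<and> usable r T t l n. (1/2) ^ (n - l - 2 * r))"
    unfolding L_def by (subst sum.Sigma) auto
  also have "\<dots> \<le> (\<Sum>l\<le>t. 2 * 4 ^ r * (1/2) ^ t * capacity r T t l)"
  proof (rule sum_mono)
    fix l
    let ?S = "{n. n \<le> t \<and> usable r T t l n}" and ?f = "first r T t l"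
    show "(\<Sum>n\<in>?S. (1/2) ^ (n - l - 2 * r)) \<le> 2 * 4 ^ r * (1/2 :: real) ^ t * capacity r T t l"
    proof (cases "?f \<le> t")
      case False
      then have "?S = {}" using first_le le_trans by blast
      then show ?thesis by (simp only: sum.empty) simp
    next
      case True
      have "(\<Sum>n\<in>?S. (1/2) ^ (n - l - 2 * r)) = (\<Sum>n\<in>?S. 2 ^ (l + 2 * r) * (1/2 :: real) ^ n)"
      proof (intro sum.cong refl)
        fix n assume "n \<in> ?S"
        then have "n = (l + 2 * r) + (n - l - 2 * r)" by (simp add: usable_def)
        then have "(1/2 :: real) ^ n = (1/2) ^ (l + 2 * r) * (1/2) ^ (n - l - 2 * r)"
          by (metis power_add)
        then show "(1/2) ^ (n - l - 2 * r) = 2 ^ (l + 2 * r) * (1/2 :: real) ^ n"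
          by (simp add: power_divide)
      qed
      also have "\<dots> \<le> (\<Sum>n\<in>{?f..t}. 2 ^ (l + 2 * r) * (1/2 :: real) ^ n)"
        by (intro sum_mono2) (auto dest: first_le)
      also have "\<dots> \<le> 2 ^ (l + 2 * r) * (2 * (1/2) ^ ?f)"
        unfolding sum_distrib_left[symmetric] by (intro mult_left_mono geometric_interval) simp
      also have "\<dots> = 2 * 4 ^ r * (1/2) ^ t * capacity r T t l"
      proof -
        have "t + l = ?f + (t + l - ?f)" using True by simp
        then have "(2::real) ^ t * 2 ^ l = 2 ^ ?f * 2 ^ (t + l - ?f)" by (metis power_add)
        moreover have "(4::real) ^ r = (2 ^ r)\<^sup>2"
          by (simp add: power2_eq_square flip: power_mult_distrib)
        ultimately show ?thesis
          using True by (simp add: capacity_def power_add power_mult power_divide field_simps)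
      qed
      finally show ?thesis .
    qed
  qed
  also have "\<dots> = 2 * 4 ^ r * (1/2) ^ t * total r T t (Suc t)"
    by (simp add: total_def sum_distrib_left lessThan_Suc_atMost)
  finally show ?thesis .
qed

text \<open>The requests are sorted by phase. A waiting phase has not covered its cylinder, so by
  \<open>active_weight\<close> its requests weigh at most \<open>2 * 4 ^ r\<close> times the measure
  of that cylinder. The cylinders of all phases are bounded by \<open>Z_weight\<close>.\<close>

lemma requested_weight:
  assumes "finite R" "\<And>n k. (n, k) \<in> R \<Longrightarrow> requested r n k"
  shows "(\<Sum>(n, k)\<in>R. 2 ^ r * (1/2) ^ k) \<le> (1/2 :: real) ^ Suc r"
proof -
  obtain \<tau> where \<tau>: "\<And>n k. (n, k) \<in> R \<Longrightarrow> waiting r (\<tau> (n, k)) \<and> active r (start r (\<tau> (n, k))) (\<tau> (n, k)) n k"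
  proof -
    have "\<forall>p\<in>R. \<exists>t. waiting r t \<and> active r (start r t) t (fst p) (snd p)"
      using assms(2) by (auto simp: requested_def)
    then obtain \<tau> where "\<forall>p\<in>R. waiting r (\<tau> p) \<and> active r (start r (\<tau> p)) (\<tau> p) (fst p) (snd p)"
      by (auto simp: bchoice_iff)
    then show thesis using that by fastforce
  qed
  define ph where "ph p = phase r (\<tau> p)" for p
  have block: "(\<Sum>(n, k)\<in>{p \<in> R. ph p = i}. (1/2) ^ k) \<le> 2 * 4 ^ r * (1/2 :: real) ^ slen i" if "i \<in> ph ` R" for i
  proof -
    define B where "B = {p \<in> R. ph p = i}"
    have B: "finite B" "B \<noteq> {}" using assms(1) that by (auto simp: B_def)
    \<comment> \<open>At the latest time of the block the phase is still waiting, and all earlier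
      requests of the block are still active.\<close>
    define t where "t = Max (\<tau> ` B)"
    have "t \<in> \<tau> ` B" unfolding t_def using B by (intro Max_in) auto
    then obtain n' k' where "(n', k') \<in> B" "t = \<tau> (n', k')" by auto
    then have t: "waiting r t" "phase r t = i" using \<tau> by (auto simp: B_def ph_def)
    have act: "active r (start r t) t n k" if "(n, k) \<in> B" for n k
    proof -
      have "\<tau> (n, k) \<le> t" unfolding t_def using B that by (intro Max_ge) auto
      moreover have "phase r (\<tau> (n, k)) = i" "(n, k) \<in> R" using that by (auto simp: B_def ph_def)
      ultimately have "active r (start r t) (\<tau> (n, k)) n k"
        using \<tau>[of n k] start_eq_of_phase_eq[of "\<tau> (n, k)" t r] t by simp
      then show ?thesis
        using \<open>\<tau> (n, k) \<le> t\<close> h_antimono[OF \<open>\<tau> (n, k) \<le> t\<close>, of n] unfolding active_def by linarith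
    qed
    have "slen i \<le> t" using slen_phase_le[of r t] phase_le_start[of r t] t by simp
    have "total r (start r t) t (Suc t) < 2 ^ (t - slen i)"
      using t by (simp add: waiting_def covered_def)
    then have "real (total r (start r t) t (Suc t)) \<le> real (2 ^ (t - slen i))"
      by (simp only: of_nat_le_iff)
    also have "\<dots> = 2 ^ (t - slen i)" by simp
    also have "\<dots> = 2 ^ t * (1/2) ^ slen i"
      using \<open>slen i \<le> t\<close> by (simp add: power_diff power_divide)
    finally have "2 * 4 ^ r * (1/2) ^ t * real (total r (start r t) t (Suc t)) \<le>
        2 * 4 ^ r * (1/2) ^ t * (2 ^ t * (1/2) ^ slen i)"
      by (intro mult_left_mono) simp_all
    also have "\<dots> = 2 * 4 ^ r * (1/2) ^ slen i" by (simp add: power_divide)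
    finally show ?thesis
      using active_weight[OF B(1) act] unfolding B_def[symmetric] by linarith
  qed
  have "(\<Sum>(n, k)\<in>R. (1/2 :: real) ^ k) = (\<Sum>i\<in>ph ` R. \<Sum>(n, k)\<in>{p \<in> R. ph p = i}. (1/2) ^ k)"
    by (rule sum.image_gen) (rule assms)
  also have "\<dots> \<le> (\<Sum>i\<in>ph ` R. 2 * 4 ^ r * (1/2) ^ slen i)" by (rule sum_mono) (rule block)
  also have "\<dots> = 2 * 4 ^ r * (\<Sum>i\<in>ph ` R. (1/2) ^ slen i)" by (simp add: sum_distrib_left)
  also have "\<dots> \<le> 2 * 4 ^ r * (1/2) ^ (4 * r + 2)"
    using assms(1) \<tau> by (intro mult_left_mono Z_weight) (auto simp: ph_def waiting_def)
  finally have "2 ^ r * (\<Sum>(n, k)\<in>R. (1/2) ^ k) \<le> 2 ^ r * (2 * 4 ^ r * (1/2 :: real) ^ (4 * r + 2))"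
    by (rule mult_left_mono) simp
  \<comment> \<open>The exponents add up to \<open>r + 1 + 2 * r - (4 * r + 2) = - r - 1\<close>;
    this is what the test level was chosen for.\<close>
  also have "\<dots> = (1/2) ^ Suc r"
  proof -
    define x y :: real where "x = (1/2) ^ r" and "y = 2 ^ r"
    have xy: "y * x = 1" by (simp add: x_def y_def power_divide)
    have "(1/2 :: real) ^ (4 * r) = x ^ 4" unfolding x_def by (metis power_mult mult.commute)
    then have "(1/2 :: real) ^ (4 * r + 2) = x ^ 4 * (1/4)"
      unfolding power_add by (simp only:) (simp add: power2_eq_square)
    moreover have "(4 :: real) ^ r = y * y" unfolding y_def by (simp flip: power_mult_distrib)
    ultimately have "2 ^ r * (2 * 4 ^ r * (1/2 :: real) ^ (4 * r + 2)) = y * (2 * (y * y) * (x ^ 4 * (1/4)))"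
      by (simp only: y_def)
    also have "\<dots> = (y * x) * (y * x) * (y * x) * x / 2" by (simp add: power4_eq_xxxx)
    also have "\<dots> = (1/2) ^ Suc r" unfolding xy by (simp add: x_def)
    finally show ?thesis .
  qed
  finally show ?thesis by (simp add: sum_distrib_left case_prod_unfold)
qed

text \<open>Otherwise a single request would exceed the weight bound. Hence \<open>k - r\<close> is
  never truncated.\<close>

lemma requested_gt: "requested r n k \<Longrightarrow> r < k"
proof (rule ccontr)
  assume req: "requested r n k" and "\<not> r < k"
  have "2 ^ r * (1/2) ^ k \<le> (1/2 :: real) ^ Suc r"
    using requested_weight[of "{(n, k)}" r] req by simp
  moreover have "(1::real) \<le> 2 ^ r * (1/2) ^ k"
    using \<open>\<not> r < k\<close> by (simp add: power_divide field_simps power_increasing)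
  moreover have "(1/2 :: real) ^ Suc r < 1" by (rule power_Suc_less_one) simp_all
  ultimately show False by linarith
qed

subsection \<open>The two machines\<close>

text \<open>A single machine serves the requests of all \<open>r\<close>, whose weights
  \<open>2^(-r-1)\<close> sum to at most 1. So \<open>c\<close> does not depend on \<open>r\<close>,
  which can later be chosen larger than \<open>c\<close>.\<close>

lemma requested_complexity:
  assumes "optimal_prefix_free U"
  shows "\<exists>c. \<forall>r n k. requested r n k \<longrightarrow> complexity U (str_of_nat n) \<le> enat (k - r + c)"
proof -
  define req where "req r t n k \<longleftrightarrow> waiting r t \<and> active r (start r t) t n k" for r t n k
  \<comment> \<open>A request is repeated at many times; counting only its first occurrence keeps
    the weight bounded.\<close>
  define new where "new r t n k \<longleftrightarrow> req r t n k \<and> (\<forall>s<t. \<not> req r s n k)" for r t n k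
  define ir where "ir = (\<lambda>i. pfst i)"
  define it where "it = (\<lambda>i. pfst (psnd i))"
  define iN where "iN = (\<lambda>i. pfst (psnd (psnd i)))"
  define ik where "ik = (\<lambda>i. psnd (psnd (psnd i)))"
  define D where "D i \<longleftrightarrow> new (ir i) (it i) (iN i) (ik i)" for i
  have requested: "requested r n k" if "new r t n k" for r t n k
    using that by (auto simp: new_def req_def requested_def)
  have new: "\<exists>t. new r t n k" if "requested r n k" for r n k
  proof -
    from that obtain t where "req r t n k" by (auto simp: requested_def req_def)
    then have "req r (LEAST t. req r t n k) n k" by (rule LeastI)
    then show ?thesis unfolding new_def using not_less_Least by blast
  qed
  have new_unique: "s = t" if "new r s n k" "new r t n k" for r s t n k
    using that unfolding new_def by (metis nat_neq_iff)
  have index_eqI: "i = j" if "ir i = ir j" "it i = it j" "iN i = iN j" "ik i = ik j" for i j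
    using that unfolding ir_def it_def iN_def ik_def
    by (metis prod.collapse prod_decode_inverse)
  have comp: "computable ir" "computable it" "computable iN" "computable ik"
    unfolding ir_def it_def iN_def ik_def by (intro computable_intros)+
  have "decidable D"
    unfolding D_def new_def req_def
    by (intro computable_intros decidable_waiting decidable_active computable_start comp
        comp[THEN computable_compose])
  moreover have "computable (\<lambda>i. ik i - ir i)" by (intro computable_intros comp)
  moreover have "(\<Sum>i<N. of_bool (D i) * (1/2) ^ (ik i - ir i)) \<le> (1::real)" for N
  proof -
    let ?I = "{i. i < N \<and> D i}"
    have part: "(\<Sum>i\<in>{i \<in> ?I. ir i = r}. (1/2) ^ (ik i - ir i)) \<le> (1/2 :: real) ^ Suc r" for r
    proof -
      let ?J = "{i \<in> ?I. ir i = r}" and ?f = "\<lambda>i. (iN i, ik i)"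
      have inj: "inj_on ?f ?J"
      proof (rule inj_onI)
        fix i j assume ij: "i \<in> ?J" "j \<in> ?J" "?f i = ?f j"
        then have "new r (it i) (iN i) (ik i)" "new r (it j) (iN i) (ik i)" by (auto simp: D_def)
        then have "it i = it j" by (rule new_unique)
        moreover have "ir i = ir j" "iN i = iN j" "ik i = ik j" using ij by simp_all
        ultimately show "i = j" by (metis index_eqI)
      qed
      have req: "requested r n k" if "(n, k) \<in> ?f ` ?J" for n k
        using that requested by (auto simp: D_def)
      have "(\<Sum>i\<in>?J. (1/2) ^ (ik i - ir i)) = (\<Sum>i\<in>?J. 2 ^ r * (1/2 :: real) ^ ik i)"
      proof (intro sum.cong refl)
        fix i assume i: "i \<in> ?J"
        then have "requested r (iN i) (ik i)" using requested by (auto simp: D_def)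
        then have "ik i = r + (ik i - r)" using requested_gt by (simp add: less_imp_le)
        then have "(1/2 :: real) ^ ik i = (1/2) ^ r * (1/2) ^ (ik i - r)" by (metis power_add)
        then show "(1/2) ^ (ik i - ir i) = 2 ^ r * (1/2 :: real) ^ ik i"
          using i by (simp add: power_divide)
      qed
      also have "\<dots> = (\<Sum>(n, k)\<in>?f ` ?J. 2 ^ r * (1/2 :: real) ^ k)"
        unfolding sum.reindex[OF inj] by simp
      also have "\<dots> \<le> (1/2) ^ Suc r"
        by (rule requested_weight) (use req in auto)
      finally show ?thesis .
    qed
    have "ir ` ?I \<subseteq> {..<N}"
    proof (rule image_subsetI)
      fix i assume "i \<in> ?I"
      moreover have "ir i \<le> i" using le_prod_encode_1[of "ir i" "psnd i"] by (simp add: ir_def)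
      ultimately show "ir i \<in> {..<N}" by simp
    qed
    have "(\<Sum>i<N. of_bool (D i) * (1/2) ^ (ik i - ir i)) = (\<Sum>i\<in>?I. (1/2 :: real) ^ (ik i - ir i))"
      by (rule sum.mono_neutral_cong_right) auto
    also have "\<dots> = (\<Sum>r\<in>ir ` ?I. \<Sum>i\<in>{i \<in> ?I. ir i = r}. (1/2) ^ (ik i - ir i))"
      by (rule sum.image_gen) simp
    also have "\<dots> \<le> (\<Sum>r\<in>ir ` ?I. (1/2) ^ Suc r)" by (rule sum_mono) (rule part)
    also have "\<dots> \<le> (\<Sum>r<N. (1/2) ^ Suc r)"
      using \<open>ir ` ?I \<subseteq> {..<N}\<close> by (intro sum_mono2) auto
    also have "\<dots> = 1 - (1/2) ^ N" by (induction N) simp_all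
    also have "\<dots> \<le> 1" by simp
    finally show ?thesis .
  qed
  ultimately obtain c where c: "\<And>i. D i \<Longrightarrow> complexity U (str_of_nat (iN i)) \<le> enat (ik i - ir i + c)"
    using optimal_prefix_free_bound[OF assms _ _ comp(3), of D "\<lambda>i. ik i - ir i"] by blast
  have "complexity U (str_of_nat n) \<le> enat (k - r + c)" if "requested r n k" for r n k
  proof -
    obtain t where "new r t n k" using new[OF \<open>requested r n k\<close>] by blast
    then show ?thesis
      using c[of "prod_encode (r, prod_encode (t, prod_encode (n, k)))"]
      by (simp add: D_def ir_def it_def iN_def ik_def)
  qed
  then show ?thesis by blast
qed

text \<open>The binary expansion of \<open>Suc (code r l e)\<close> consists of \<open>r + 1\<close> ones, a zero and the \<open>l + 1\<close> digits of \<open>e\<close>.\<close>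

definition code :: "nat \<Rightarrow> nat \<Rightarrow> nat \<Rightarrow> nat" where
  "code r l e = (2 ^ (r + 2) - 2) * 2 ^ Suc l + e - 1"

lemma Suc_code: "Suc (code r l e) = (2 ^ (r + 2) - 2) * 2 ^ Suc l + e"
proof -
  have "(1::nat) \<le> 2 ^ r" by simp
  moreover have "(2::nat) ^ (r + 2) = 4 * 2 ^ r" by (simp add: power_add)
  ultimately have "(2::nat) ^ (r + 2) - 2 > 0" by linarith
  then have "(2 ^ (r + 2) - 2) * 2 ^ Suc l > (0::nat)" by simp
  then show ?thesis unfolding code_def by linarith
qed

text \<open>The expansion has \<open>r + l + 3\<close> digits, and the leading one does not belong
  to the string.\<close>

lemma slen_code:
  assumes "e < 2 ^ Suc l" shows "slen (code r l e) = r + l + 2"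
proof (rule slen_eqI)
  have "(2::nat) ^ (r + l + 2) = 2 ^ Suc r * 2 ^ Suc l" by (simp add: power_add)
  also have "\<dots> \<le> (2 ^ (r + 2) - 2) * 2 ^ Suc l"
  proof (rule mult_right_mono)
    have "(1::nat) \<le> 2 ^ r" by simp
    moreover have "(2::nat) ^ (r + 2) = 4 * 2 ^ r" "(2::nat) ^ Suc r = 2 * 2 ^ r" by (simp_all add: power_add)
    ultimately show "(2::nat) ^ Suc r \<le> 2 ^ (r + 2) - 2" by linarith
  qed simp
  finally show "2 ^ (r + l + 2) \<le> Suc (code r l e)" unfolding Suc_code by (rule trans_le_add1)
  have "Suc (code r l e) < (2 ^ (r + 2) - 2) * 2 ^ Suc l + 2 ^ Suc l" using assms unfolding Suc_code by simp
  also have "\<dots> = Suc (2 ^ (r + 2) - 2) * 2 ^ Suc l" by simp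
  also have "\<dots> \<le> 2 ^ (r + 2) * 2 ^ Suc l" by (intro mult_right_mono) (simp_all add: Suc_le_eq)
  also have "\<dots> = 2 ^ Suc (r + l + 2)" by (simp add: power_add)
  finally show "Suc (code r l e) < 2 ^ Suc (r + l + 2)" .
qed

text \<open>Among codes of equal length, one with fewer leading ones is smaller as a number.\<close>

lemma code_inj_le:
  assumes "e < 2 ^ Suc l" "e' < 2 ^ Suc l'" "code r l e = code r' l' e'"
  shows "r' \<le> r"
proof (rule ccontr)
  assume "\<not> r' \<le> r"
  then obtain u where u: "r' = r + Suc u" by (metis add_Suc_right less_imp_Suc_add not_le)
  have "r + l = r' + l'" using slen_code[OF assms(1), of r] slen_code[OF assms(2), of r'] assms(3) by simp
  then have l: "l = l' + Suc u" using u by simp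
  have "Suc (code r l e) < (2 ^ (r + 2) - 2) * 2 ^ Suc l + 2 ^ Suc l" using assms unfolding Suc_code by simp
  also have "\<dots> = (2 ^ (r + 2) - 1) * 2 ^ Suc u * 2 ^ Suc l'"
    by (simp add: l power_add algebra_simps diff_mult_distrib)
  also have "\<dots> = (2 ^ (r' + 2) - 2 ^ Suc u) * 2 ^ Suc l'"
    by (simp add: u power_add diff_mult_distrib)
  also have "\<dots> \<le> (2 ^ (r' + 2) - 2) * 2 ^ Suc l'"
    by (intro mult_right_mono diff_le_mono2) simp_all
  also have "\<dots> \<le> Suc (code r' l' e')" unfolding Suc_code by simp
  finally show False using assms(3) by simp
qed

lemma code_inj:
  assumes "e < 2 ^ Suc l" "e' < 2 ^ Suc l'" "code r l e = code r' l' e'"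
  shows "r = r' \<and> l = l' \<and> e = e'"
proof -
  have r: "r = r'" using code_inj_le[OF assms] code_inj_le[OF assms(2,1) assms(3)[symmetric]] by simp
  have "r + l = r' + l'" using slen_code[OF assms(1), of r] slen_code[OF assms(2), of r'] assms(3) by simp
  then have l: "l = l'" using r by simp
  have "Suc (code r l e) = Suc (code r' l' e')" using assms(3) by simp
  then show ?thesis using r l unfolding Suc_code by simp
qed

text \<open>\<open>e\<close> has \<open>l + 1\<close> digits instead of \<open>l\<close>, because
  the share of code length \<open>l\<close> need not begin at a multiple of the block size and may
  meet one block more than \<open>2 ^ l\<close>.\<close>

definition described :: "nat \<Rightarrow> nat \<Rightarrow> nat \<Rightarrow> nat \<Rightarrow> bool" where
  "described r t l e \<longleftrightarrow> succeeding r t \<and> first r (start r t) t l \<le> t \<and> e < 2 ^ Suc l"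

text \<open>In numbers with a leading one, the first summand is the leftmost extension of the
  phase's string to length \<open>n\<close>; the offset rounded down to length \<open>n\<close> and
  the block number \<open>e\<close> are added to it.\<close>

definition described_string :: "nat \<Rightarrow> nat \<Rightarrow> nat \<Rightarrow> nat \<Rightarrow> nat" where
  "described_string r t l e =
     (let n = first r (start r t) t l
      in Suc (phase r t) * 2 ^ (n - slen (phase r t)) + total r (start r t) t l div 2 ^ (t - n) + e - 1)"

text \<open>If \<open>s < t\<close>, then \<open>l \<le> s < start r t < l\<close>. Therefore a code
  need not contain the time of success.\<close>

lemma described_unique:
  assumes "described r s l e" "described r t l e'"
  shows "s = t"
proof -
  have False if "described r s l e" "described r t l e'" "s < t" for s t e e'
  proof -
    have "l \<le> s" using that(1) usable_bounds[OF first_usable, of r "start r s" s l]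
      by (simp add: described_def)
    moreover have "start r t < l" using that(2) usable_bounds[OF first_usable, of r "start r t" t l]
      by (simp add: described_def)
    moreover have "s < start r t" using that start_after_success by (simp add: described_def)
    ultimately show False by simp
  qed
  then show ?thesis using assms by (metis nat_neq_iff)
qed

lemma described_complexity:
  assumes "optimal_plain V"
  shows "\<exists>c. \<forall>r t l e. described r t l e \<longrightarrow>
    complexity V (str_of_nat (described_string r t l e)) \<le> enat (r + l + 2 + c)"
proof -
  define ir where "ir = (\<lambda>i. pfst i)"
  define it where "it = (\<lambda>i. pfst (psnd i))"
  define il where "il = (\<lambda>i. pfst (psnd (psnd i)))"
  define ie where "ie = (\<lambda>i. psnd (psnd (psnd i)))"
  define D where "D i \<longleftrightarrow> described (ir i) (it i) (il i) (ie i)" for i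
  define out where "out i = described_string (ir i) (it i) (il i) (ie i)" for i
  define cd where "cd i = code (ir i) (il i) (ie i)" for i
  have comp: "computable ir" "computable it" "computable il" "computable ie"
    unfolding ir_def it_def il_def ie_def by (intro computable_intros)+
  have "decidable D" unfolding D_def described_def
    by (intro computable_intros decidable_succeeding computable_first computable_start comp)
  moreover have "computable cd" unfolding cd_def code_def by (intro computable_intros comp)
  moreover have "computable out" unfolding out_def described_string_def Let_def
    by (intro computable_intros computable_first computable_start computable_phase computable_total comp)
  moreover have "out i = out j" if "D i" "D j" "cd i = cd j" for i j
  proof -
    have eq: "ir i = ir j" "il i = il j" "ie i = ie j"
      using code_inj[of "ie i" "il i" "ie j" "il j" "ir i" "ir j"] that
      by (simp_all add: D_def described_def cd_def)
    moreover have "it i = it j"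
      by (rule described_unique[of "ir i" _ "il i" "ie i" _ "ie j"]) (use that eq in \<open>simp_all add: D_def\<close>)
    ultimately show ?thesis by (simp add: out_def)
  qed
  ultimately obtain c where c: "\<And>i. D i \<Longrightarrow> complexity V (str_of_nat (out i)) \<le> enat (slen (cd i) + c)"
    using optimal_plain_bound[OF assms, of D cd out] by blast
  have "complexity V (str_of_nat (described_string r t l e)) \<le> enat (r + l + 2 + c)"
    if "described r t l e" for r t l e
    using c[of "prod_encode (r, prod_encode (t, prod_encode (l, e)))"] that slen_code[of e l r]
    by (simp add: D_def out_def cd_def ir_def it_def il_def ie_def described_def)
  then show ?thesis by blast
qed

text \<open>The position \<open>x\<close> of \<open>X\<close> among the strings of length
  \<open>t\<close> in the cylinder falls into the share of some code length \<open>l\<close>.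
  Dividing by \<open>2 ^ (t - n)\<close> turns it into the position of the prefix of length
  \<open>n\<close>.\<close>

lemma success_describes_prefix:
  assumes t: "succeeding r t" and X: "restr X (slen (phase r t)) = str_of_nat (phase r t)"
  shows "\<exists>l n e. usable r (start r t) t l n \<and> described r t l e \<and>
    str_of_nat (described_string r t l e) = restr X n"
proof -
  define i T L where "i = phase r t" and "T = start r t" and "L = slen i"
  define B where "B m = Suc (nat_of_str (restr X m))" for m
  have "L \<le> T" "T \<le> t" using slen_phase_le phase_le_start by (auto simp: L_def i_def T_def)
  have B_div: "B m div 2 ^ (m - k) = B k" if "k \<le> m" for k m
  proof -
    have "restr X m = restr X k @ drop k (restr X m)" using take_restr[OF that, of X] by (metis append_take_drop_id)
    then show ?thesis
      using Suc_nat_of_str_append_div[of "restr X k" "drop k (restr X m)"] by (simp add: B_def)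
  qed
  have B_L: "B L = Suc i" using X by (simp add: B_def L_def i_def)
  define x where "x = B t mod 2 ^ (t - L)"
  have B_t: "B t = Suc i * 2 ^ (t - L) + x"
  proof -
    have "B t div 2 ^ (t - L) = Suc i" using B_div[OF le_trans[OF \<open>L \<le> T\<close> \<open>T \<le> t\<close>]] by (simp only: B_L)
    then show ?thesis using div_mult_mod_eq[of "B t" "2 ^ (t - L)"] by (simp only: x_def)
  qed
  have "x < 2 ^ (t - L)" by (simp add: x_def)
  also have "\<dots> \<le> total r T t (Suc t)" using t by (simp add: succeeding_def covered_def L_def i_def T_def)
  finally have x_less: "x < total r T t (Suc t)" .
  define l where "l = (LEAST l. x < total r T t (Suc l))"
  have upper: "x < total r T t (Suc l)" unfolding l_def by (rule LeastI) (rule x_less)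
  have lower: "total r T t l \<le> x"
  proof (cases l)
    case 0
    then show ?thesis by (simp add: total_def)
  next
    case (Suc l')
    then have "\<not> x < total r T t (Suc l')" using not_less_Least[of l' "\<lambda>l. x < total r T t (Suc l)"] by (simp add: l_def)
    then show ?thesis using Suc by simp
  qed
  have total_Suc: "total r T t (Suc l) = total r T t l + capacity r T t l" by (simp add: total_def)
  define n where "n = first r T t l"
  have "capacity r T t l \<noteq> 0" using upper lower total_Suc by linarith
  then have "n \<le> t" by (auto simp: capacity_def n_def split: if_splits)
  then have usable: "usable r T t l n" unfolding n_def by (rule first_usable)
  have "L \<le> n" "l \<le> n" using usable_bounds[OF usable] \<open>L \<le> T\<close> by simp_all
  define d where "d = (2::nat) ^ (t - n)"
  have "d > 0" by (simp add: d_def)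
  have "t + l - n = l + (t - n)" using \<open>n \<le> t\<close> by simp
  then have "2 ^ (t + l - n) = 2 ^ l * d" by (simp only: power_add d_def)
  then have capacity: "capacity r T t l = 2 ^ l * d"
    using \<open>n \<le> t\<close> by (simp add: capacity_def flip: n_def)
  define e where "e = x div d - total r T t l div d"
  have "x div d \<le> (total r T t l + 2 ^ l * d) div d"
    using upper total_Suc capacity by (intro div_le_mono) simp
  also have "\<dots> = total r T t l div d + 2 ^ l" using \<open>d > 0\<close> by simp
  \<comment> \<open>Equality can occur when the offset is not a multiple of
    \<open>d\<close>.\<close>
  finally have "e \<le> 2 ^ l" by (simp add: e_def)
  then have "e < 2 ^ Suc l" by (rule le_less_trans) simp
  have e: "total r T t l div d + e = x div d" using div_le_mono[OF lower, of d] by (simp add: e_def)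
  have "t - L = (n - L) + (t - n)" using \<open>L \<le> n\<close> \<open>n \<le> t\<close> by simp
  then have "B t = x + Suc i * 2 ^ (n - L) * d" by (simp only: B_t d_def power_add mult.assoc add.commute)
  then have "B n = Suc i * 2 ^ (n - L) + x div d"
    using B_div[OF \<open>n \<le> t\<close>] \<open>d > 0\<close> by (simp add: d_def[symmetric] del: mult_Suc)
  then have "described_string r t l e = nat_of_str (restr X n)"
    using e by (simp add: described_string_def Let_def B_def d_def i_def L_def n_def T_def)
  moreover have "described r t l e"
    using t \<open>n \<le> t\<close> \<open>e < 2 ^ Suc l\<close> by (simp add: described_def n_def T_def)
  ultimately show ?thesis using usable unfolding T_def by (metis str_of_nat_of_str)
qed

text \<open>If the phases pass \<open>j\<close>, that phase was left by success. If not, they are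
  bounded and finally constant, perhaps at a string before \<open>j\<close>.\<close>

lemma phases_dichotomy:
  assumes "Z r j"
  shows "(\<exists>t. succeeding r t \<and> phase r t = j) \<or> (\<exists>s. \<forall>t\<ge>s. waiting r t \<and> start r t = start r s)"
proof (cases "\<exists>t. j < phase r t")
  case True
  define t where "t = (LEAST t. j < phase r t)"
  have t: "j < phase r t" unfolding t_def using True by (rule LeastI_ex)
  have "t \<noteq> 0"
  proof
    assume "t = 0"
    then show False using t by (simp add: phase_def state_def)
  qed
  then obtain s where s: "t = Suc s" using not0_implies_Suc by blast
  have "\<not> j < phase r s" using not_less_Least[of s "\<lambda>t. j < phase r t"] s by (simp add: t_def)
  then have "phase r s = j" "\<not> waiting r s" using t s by (auto simp: state_Suc split: if_splits)
  then have "succeeding r s" using assms by (simp add: waiting_def succeeding_def)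
  with \<open>phase r s = j\<close> show ?thesis by blast
next
  case False
  then have "range (phase r) \<subseteq> {..j}" by (auto simp: not_less)
  then have "finite (range (phase r))" by (rule finite_subset) simp
  then have "Max (range (phase r)) \<in> range (phase r)" by (intro Max_in) auto
  then obtain s where s: "phase r s = Max (range (phase r))" by force
  have const: "phase r t = phase r s" if "s \<le> t" for t
    using phase_mono[OF that, of r] \<open>finite (range (phase r))\<close> by (intro antisym) (auto simp: s)
  have "waiting r t \<and> start r t = start r s" if "s \<le> t" for t
  proof
    show "waiting r t" using const[OF that] const[of "Suc t"] that by (auto simp: state_Suc split: if_splits)
    show "start r t = start r s" using start_eq_of_phase_eq[OF that, of r] const[OF that] by simp
  qed
  then show ?thesis by blast
qed

end

section \<open>Sequences that are not random have compressible prefixes\<close>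

text \<open>It serves to verify \<open>2 * k \<le> n\<close> for \<open>k = g n\<close> at large
  \<open>n\<close> where \<open>g\<close> is tight. Each value of \<open>i div 3\<close> occurs
  three times, so the weights \<open>2^(-(i div 3) - 3)\<close> sum to at most 3/4.\<close>

lemma complexity_le_third:
  assumes "optimal_prefix_free U"
  shows "\<exists>c. \<forall>n. complexity U (str_of_nat n) \<le> enat (n div 3 + c)"
proof -
  have "(\<Sum>i<3 * M. (1/2) ^ (i div 3 + 3)) = 3/4 * (1 - (1/2 :: real) ^ M)" for M
  proof (induction M)
    case (Suc M)
    have "(\<Sum>i<3 * Suc M. (1/2 :: real) ^ (i div 3 + 3)) = (\<Sum>i<3 * M. (1/2) ^ (i div 3 + 3)) + 3 * (1/2) ^ (M + 3)"
    proof -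
      have "3 * Suc M = Suc (Suc (Suc (3 * M)))" by simp
      moreover have "3 * M div 3 = M" "Suc (3 * M) div 3 = M" "Suc (Suc (3 * M)) div 3 = M" by presburger+
      ultimately show ?thesis by (simp only: sum.lessThan_Suc)
    qed
    also have "\<dots> = 3/4 * (1 - (1/2) ^ M) + 3/8 * (1/2) ^ M"
      unfolding Suc.IH by (simp add: power_add power3_eq_cube)
    finally show ?case by (simp add: field_simps)
  qed simp
  moreover have "(\<Sum>i<N. (1/2 :: real) ^ (i div 3 + 3)) \<le> (\<Sum>i<3 * N. (1/2) ^ (i div 3 + 3))" for N
    by (intro sum_mono2) auto
  ultimately have le: "(\<Sum>i<N. (1/2 :: real) ^ (i div 3 + 3)) \<le> 3/4 * (1 - (1/2) ^ N)" for N by metis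
  have "3/4 * (1 - (1/2) ^ N) \<le> (1 :: real)" for N
  proof -
    have "(0 :: real) \<le> (1/2) ^ N" by simp
    then show ?thesis by argo
  qed
  from order_trans[OF le this] have "(\<Sum>i<N. of_bool True * (1/2) ^ (i div 3 + 3)) \<le> (1 :: real)" for N
    by (simp only: of_bool_eq mult_1_left)
  moreover have "computable (\<lambda>i. i div 3 + 3)" "computable (\<lambda>i. i)" "decidable (\<lambda>i. True)"
    by (intro computable_intros)+
  ultimately obtain c where "\<And>n. complexity U (str_of_nat n) \<le> enat (n div 3 + 3 + c)"
    using optimal_prefix_free_bound[OF assms, of "\<lambda>_. True" "\<lambda>i. i div 3 + 3" "\<lambda>i. i"] by blast
  then show ?thesis by (metis add.assoc)
qed

theorem complex_imp_ml_random:
  assumes U: "optimal_prefix_free U" and V: "optimal_plain V" and g: "right_ce g"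
    and tight: "\<exists>\<^sub>\<infinity>n. enat (g n) \<le> complexity U (str_of_nat n) + enat cg"
    and complex: "\<And>n. enat n \<le> complexity V (restr A n) + enat (g n) + enat c"
  shows "ml_random A"
proof (rule ccontr)
  assume "\<not> ml_random A"
  then obtain W where W: "ml_test W" "\<And>m. A \<in> open_of (W m)" unfolding ml_random_def by blast
  obtain Z where Z: "decidable (\<lambda>z. Z (pfst z) (psnd z))"
    "\<And>m F. finite F \<Longrightarrow> (\<And>i. i \<in> F \<Longrightarrow> Z m i) \<Longrightarrow> (\<Sum>i\<in>F. (1/2) ^ slen i) \<le> (1/2 :: real) ^ m"
    "\<And>m X. X \<in> open_of (W m) \<Longrightarrow> \<exists>n. Z m (nat_of_str (restr X n))"
    using ml_test_decidable_generators[OF W(1)] by blast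
  obtain h where h: "computable (\<lambda>z. h (pfst z) (psnd z))" "\<And>n s t. s \<le> t \<Longrightarrow> h n t \<le> h n s"
    "\<And>n t. g n \<le> h n t" "\<And>n. eventually (\<lambda>t. h n t = g n) sequentially"
    using right_ceE[OF g] by blast
  have "computable (\<lambda>z. prod_encode (4 * pfst z + 2, psnd z))" by (intro computable_intros)
  from decidable_compose[OF Z(1) this] have Z': "decidable (\<lambda>z. Z (4 * pfst z + 2) (psnd z))"
    by (simp only: prod_encode_inverse fst_conv snd_conv)
  interpret compression h "\<lambda>r. Z (4 * r + 2)"
  proof
    show "(\<Sum>i\<in>F. (1/2) ^ slen i) \<le> (1/2 :: real) ^ (4 * r + 2)"
      if "finite F" "\<And>i. i \<in> F \<Longrightarrow> Z (4 * r + 2) i" for r F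
      using that by (rule Z(2))
  qed (fact h(1) Z' | erule h(2))+
  obtain cU where cU: "\<And>r n k. requested r n k \<Longrightarrow> complexity U (str_of_nat n) \<le> enat (k - r + cU)"
    using requested_complexity[OF U] by blast
  obtain cV where cV: "\<And>r t l e. described r t l e \<Longrightarrow>
      complexity V (str_of_nat (described_string r t l e)) \<le> enat (r + l + 2 + cV)"
    using described_complexity[OF V] by blast
  obtain c3 where c3: "\<And>n. complexity U (str_of_nat n) \<le> enat (n div 3 + c3)"
    using complexity_le_third[OF U] by blast
  \<comment> \<open>Success yields \<open>r \<le> c + cV + 2\<close> and a phase that never ends
    yields \<open>r \<le> cU + cg\<close>. None of these constants depends on \<open>r\<close>, so
    both can be violated.\<close>
  define r where "r = c + cV + cU + cg + 3"
  obtain N where "Z (4 * r + 2) (nat_of_str (restr A N))" using Z(3)[OF W(2)] by blast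
  from phases_dichotomy[OF this] consider
    (success) t where "succeeding r t" "phase r t = nat_of_str (restr A N)" |
    (stuck) s where "\<And>t. s \<le> t \<Longrightarrow> waiting r t \<and> start r t = start r s"
    by blast
  then show False
  proof cases
    case success
    then obtain l n e where lne: "usable r (start r t) t l n" "described r t l e"
        "str_of_nat (described_string r t l e) = restr A n"
      using success_describes_prefix[of r t A] by auto
    have "complexity V (restr A n) \<le> enat (r + l + 2 + cV)" using cV[OF lne(2)] lne(3) by simp
    then have "complexity V (restr A n) + enat (g n) + enat c \<le> enat (r + l + 2 + cV) + enat (g n) + enat c"
      by (intro add_right_mono)
    from order_trans[OF complex[of n] this] have "n \<le> r + l + 2 + cV + g n + c" by simp
    moreover have "l + 2 * r \<le> n" "g n \<le> n - l - 2 * r"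
      using lne(1) h(3)[of n t] by (auto simp: usable_def active_def)
    ultimately show False by (simp add: r_def)
  next
    case stuck
    define T where "T = start r s"
    \<comment> \<open>\<open>2 * T + 4 * r\<close> makes \<open>n\<close> large enough for the
      phase, and \<open>6 * c3 + 6 * cg\<close> gives
      \<open>2 * (n/3 + c3 + cg) \<le> n\<close>.\<close>
    obtain n where n: "n > 2 * T + 4 * r + 6 * c3 + 6 * cg" "enat (g n) \<le> complexity U (str_of_nat n) + enat cg"
      using tight unfolding INFM_nat by blast
    have "complexity U (str_of_nat n) + enat cg \<le> enat (n div 3 + c3) + enat cg"
      by (intro add_right_mono c3)
    from order_trans[OF n(2) this] have "g n \<le> n div 3 + c3 + cg" by simp
    then have "2 * g n \<le> n" using n(1) by linarith
    obtain t0 where t0: "\<And>t. t \<ge> t0 \<Longrightarrow> h n t = g n" using h(4)[of n] by (auto simp: eventually_sequentially)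
    define t where "t = max s (max n t0)"
    have "waiting r t" "start r t = T" using stuck[of t] by (simp_all add: t_def T_def)
    moreover have "active r T t n (g n)"
      using n(1) \<open>2 * g n \<le> n\<close> t0[of t] by (simp add: active_def t_def)
    ultimately have req: "requested r n (g n)" unfolding requested_def by metis
    have "complexity U (str_of_nat n) + enat cg \<le> enat (g n - r + cU) + enat cg"
      by (intro add_right_mono cU req)
    from order_trans[OF n(2) this] have "g n \<le> g n - r + cU + cg" by simp
    with requested_gt[OF req] show False by (simp add: r_def)
  qed
qed

text \<open>The inequality is additive because \<open>n - g n\<close> may be negative, where
  subtraction would truncate.\<close>

theorem mainTheorem7:
  fixes U V :: machine and g :: "nat \<Rightarrow> nat" and A :: "nat \<Rightarrow> bool"
  assumes "optimal_prefix_free U"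
    and "optimal_plain V"
    and "weak_solovay U g"
  shows "ml_random A \<longleftrightarrow>
    (\<exists>c::nat. \<forall>n. enat n \<le> complexity V (restr A n) + enat (g n) + enat c)"
proof
  obtain d cg where g: "right_ce g" "\<And>n. complexity U (str_of_nat n) \<le> enat (g n) + enat d"
    "\<exists>\<^sub>\<infinity>n. enat (g n) \<le> complexity U (str_of_nat n) + enat cg"
    using assms(3) unfolding weak_solovay_def by blast
  show "\<exists>c::nat. \<forall>n. enat n \<le> complexity V (restr A n) + enat (g n) + enat c" if "ml_random A"
    using assms(1,2) that g(1,2)
    by (intro ml_random_imp_complex[of U V g d]) (auto simp: optimal_prefix_free_def optimal_plain_def)
  show "ml_random A" if "\<exists>c::nat. \<forall>n. enat n \<le> complexity V (restr A n) + enat (g n) + enat c"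
    using that complex_imp_ml_random[OF assms(1,2) g(1,3)] by blast
qed

end
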